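(* Let $S\subset\mathbb{Z}^d$ be a finite set symmetric about the origin, $\mathcal{P}=\{P_\alpha\}_{\alpha\in S}$ a resolution of unity on $\mathbb{C}^D$, $\mu\in\mathbb{C}^D$ a unit vector, and $C_\mu\phi=2\langle\phi,\mu\rangle\mu-\phi$. Assume $\|P_\alpha\mu\|=\|P_{-\alpha}\mu\|$ for all $\alpha\in S$. Define, for $z\in T^d\setminus E$, $$w_o(z)=\frac{\mu-\eta(z)\mu}{\|\mu-\eta(z)\mu\|}=\Big(\sum_{\alpha\in S}\frac{\|P_\alpha\mu\|^2}{|1+z^\alpha|^2}\Big)^{-1/2}\sum_{\alpha\in S}\frac{z^\alpha}{1+z^\alpha}P_\alpha\mu ,$$ regarded as an element of $L^2(T^d,\mathbb{C}^D)$, and let $w=\mathcal{F}^{-1}w_o\in\ell^2(\mathbb{Z}^d,\mathbb{C}^D)$. Then the eigenspace of $U(S,\mathcal{P},C_\mu)$ for the eigenvalue $1$ equals $\{f\ast w: f\in\ell^2(\mathbb{Z}^d)\}$, where $(f\ast w)(x)=\sum_{y\in\mathbb{Z}^d}f(x-y)w(y)$.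
   Context: A resolution of unity: orthogonal projections $P_\alpha$ on $\mathbb{C}^D$, $P_\alpha P_\beta=0$ ($\alpha\neq\beta$), $\sum_\alpha P_\alpha=I$. $(\tau^\alpha f)(x)=f(x-\alpha)$ on $\ell^2(\mathbb{Z}^d,\mathbb{C}^D)$, $U(S,\mathcal{P},C)=\big(\sum_{\alpha\in S}\tau^\alpha P_\alpha\big)C$ with $C$ acting pointwise. Inner products are linear in the first argument. $T^d=\{z\in\mathbb{C}^d:|z_j|=1\}$ with normalized Haar measure $\nu$, $z^\alpha=\prod z_j^{\alpha_j}$. $E=\bigcup_{\alpha\in S}\{z:z^\alpha=-1\}$ (with $z^0=1$, so $\alpha=0$ contributes nothing) and $\eta(z)=\sum_{\alpha\in S}\frac{1-z^\alpha}{1+z^\alpha}P_\alpha$. The Fourier transform $\mathcal{F}:\ell^2(\mathbb{Z}^d,\mathbb{C}^D)\to L^2(T^d,\mathbb{C}^D)$ is $(\mathcal{F}f)(z)=\sum_x f(x)z^x$, with inverse $(\mathcal{F}^{-1}g)(x)=\int_{T^d}z^{-x}g(z)\,d\nu(z)$. $\ell^2(\mathbb{Z}^d)$ is the space of square-summable complex functions on $\mathbb{Z}^d$. *)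

theory Defs
  imports "HOL-Analysis.Analysis"
begin

(* Lattice points of Z^d are int^'d; points of the torus T^d are functions 'd => complex;
   C^D is complex^'n. Matrices are complex^'n^'n. *)

definition cinner :: "complex^'n \<Rightarrow> complex^'n \<Rightarrow> complex" where
  "cinner x y = (\<Sum>i\<in>UNIV. x$i * cnj (y$i))"

definition cadj :: "complex^'n^'n \<Rightarrow> complex^'n^'n" where
  "cadj A = (\<chi> i j. cnj (A$j$i))"

definition cmat_scale :: "complex \<Rightarrow> complex^'n^'m \<Rightarrow> complex^'n^'m" where
  "cmat_scale c A = (\<chi> i j. c * A$i$j)"

definition orth_proj :: "complex^'n^'n \<Rightarrow> bool" where
  "orth_proj P \<longleftrightarrow> P ** P = P \<and> cadj P = P"

definition resolution_of_unity :: "(int^'d) set \<Rightarrow> (int^'d \<Rightarrow> complex^'n^'n) \<Rightarrow> bool" where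
  "resolution_of_unity S P \<longleftrightarrow>
     (\<forall>\<alpha>\<in>S. orth_proj (P \<alpha>)) \<and>
     (\<forall>\<alpha>\<in>S. \<forall>\<beta>\<in>S. \<alpha> \<noteq> \<beta> \<longrightarrow> P \<alpha> ** P \<beta> = 0) \<and>
     (\<Sum>\<alpha>\<in>S. P \<alpha>) = mat 1"

definition coin :: "complex^'n \<Rightarrow> complex^'n \<Rightarrow> complex^'n" where
  "coin \<mu> \<phi> = (2 * cinner \<phi> \<mu>) *s \<mu> - \<phi>"

definition l2v :: "(int^'d \<Rightarrow> complex^'n) \<Rightarrow> bool" where
  "l2v f \<longleftrightarrow> (\<lambda>x. (norm (f x))\<^sup>2) summable_on UNIV"

definition l2s :: "(int^'d \<Rightarrow> complex) \<Rightarrow> bool" where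
  "l2s f \<longleftrightarrow> (\<lambda>x. (cmod (f x))\<^sup>2) summable_on UNIV"

definition shift :: "int^'d \<Rightarrow> (int^'d \<Rightarrow> 'a) \<Rightarrow> (int^'d \<Rightarrow> 'a)" where
  "shift \<alpha> f = (\<lambda>x. f (x - \<alpha>))"

definition walk_op :: "(int^'d) set \<Rightarrow> (int^'d \<Rightarrow> complex^'n^'n) \<Rightarrow> (complex^'n \<Rightarrow> complex^'n)
    \<Rightarrow> (int^'d \<Rightarrow> complex^'n) \<Rightarrow> (int^'d \<Rightarrow> complex^'n)" where
  "walk_op S P C f = (\<lambda>x. \<Sum>\<alpha>\<in>S. shift \<alpha> (\<lambda>y. P \<alpha> *v C (f y)) x)"

definition torus_pow :: "('d::finite \<Rightarrow> complex) \<Rightarrow> int^'d \<Rightarrow> complex" where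
  "torus_pow z \<alpha> = (\<Prod>j\<in>UNIV. z j powi (\<alpha> $ j))"

definition haar_torus :: "('d::finite \<Rightarrow> complex) measure" where
  "haar_torus = (\<Pi>\<^sub>M j\<in>UNIV. distr (restrict_space lborel {0..1::real}) borel (\<lambda>t. cis (2 * pi * t)))"

definition torus_E :: "(int^'d) set \<Rightarrow> ('d::finite \<Rightarrow> complex) set" where
  "torus_E S = (\<Union>\<alpha>\<in>S. {z. torus_pow z \<alpha> = -1})"

definition eta :: "(int^'d) set \<Rightarrow> (int^'d \<Rightarrow> complex^'n^'n) \<Rightarrow> ('d::finite \<Rightarrow> complex) \<Rightarrow> complex^'n^'n" where
  "eta S P z = (\<Sum>\<alpha>\<in>S. cmat_scale ((1 - torus_pow z \<alpha>) / (1 + torus_pow z \<alpha>)) (P \<alpha>))"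

text \<open>w_o(z) = (mu - eta(z) mu)/||mu - eta(z) mu|| on T^d minus E (set to 0 on the null set E).\<close>
definition w_o :: "(int^'d) set \<Rightarrow> (int^'d \<Rightarrow> complex^'n^'n) \<Rightarrow> complex^'n \<Rightarrow> ('d::finite \<Rightarrow> complex) \<Rightarrow> complex^'n" where
  "w_o S P \<mu> z = (if z \<in> torus_E S then 0 else
     (let v = \<mu> - eta S P z *v \<mu> in inverse (norm v) *\<^sub>R v))"

definition inv_fourier :: "(('d::finite \<Rightarrow> complex) \<Rightarrow> complex^'n) \<Rightarrow> int^'d \<Rightarrow> complex^'n" where
  "inv_fourier g x = integral\<^sup>L haar_torus (\<lambda>z. torus_pow z (- x) *s g z)"

definition conv :: "(int^'d \<Rightarrow> complex) \<Rightarrow> (int^'d \<Rightarrow> complex^'n) \<Rightarrow> int^'d \<Rightarrow> complex^'n" where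
  "conv f w x = (\<Sum>\<^sub>\<infinity>y\<in>UNIV. f (x - y) *s w y)"

end

theory Submission
  imports Defs
begin

text \<open>Under the Fourier transform the walk becomes multiplication by the matrix symbol
  \<open>\<Sum>\<^sub>\<alpha> z\<^sup>\<alpha> P\<^sub>\<alpha> C\<close>. Applying \<open>P\<^sub>\<beta>\<close> to the eigenvalue equation for a vector \<open>\<phi>\<close> gives
  \<open>(1 + z\<^sup>\<beta>) P\<^sub>\<beta> \<phi> = 2 z\<^sup>\<beta> \<langle>\<phi>, \<mu>\<rangle> P\<^sub>\<beta> \<mu>\<close>, so off the null set \<open>E\<close> the fixed vectors of the symbol
  lie on the line spanned by \<open>w\<^sub>o(z)\<close>; conversely that line is fixed because the symmetry of
  \<open>\<parallel>P\<^sub>\<alpha> \<mu>\<parallel>\<close> pairs \<open>\<alpha>\<close> with \<open>- \<alpha>\<close> and yields \<open>\<langle>\<mu> - \<eta>(z) \<mu>, \<mu>\<rangle> = 1\<close>. Hence the eigenspace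
  consists of the products \<open>h w\<^sub>o\<close> with \<open>h\<close> square integrable, which Parseval's identity turns
  into convolutions. For Fourier series on the torus, uniqueness of the coefficients comes from the
  Stone--Weierstrass theorem, and existence of a function with given square summable coefficients
  from a fast, hence almost everywhere convergent, sequence of partial sums.\<close>

section \<open>Haar measure and characters of the torus\<close>

text \<open>The measure \<open>haar_torus\<close> is defined on all functions
  \<open>'d \<Rightarrow> complex\<close>, so the torus is carried along as a set of full measure
  and identities for characters are used almost everywhere.\<close>

definition torus :: "('d::finite \<Rightarrow> complex) set" where
  "torus = {z. \<forall>j. cmod (z j) = 1}"

abbreviation circle_measure :: "complex measure" where
  "circle_measure \<equiv> distr (restrict_space lborel {0..1::real}) borel (\<lambda>t. cis (2 * pi * t))"

lemma measurable_cis_restrict [measurable]: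
  "(\<lambda>t. cis (2 * pi * t)) \<in> restrict_space lborel {0..1::real} \<rightarrow>\<^sub>M borel"
  by (intro measurable_restrict_space1) (auto intro!: borel_measurable_continuous_onI continuous_intros)

lemma measurable_power_int [measurable]:
  "(\<lambda>u::complex. u powi n) \<in> borel_measurable borel"
  unfolding power_int_def by measurable

lemma emeasure_circle_sphere: "emeasure circle_measure (sphere 0 1) = 1"
proof -
  have "(\<lambda>t. cis (2 * pi * t)) -` sphere 0 1 = UNIV"
    by auto
  then show ?thesis
    by (subst emeasure_distr) (auto simp: space_restrict_space emeasure_restrict_space)
qed

lemma emeasure_circle_UNIV: "emeasure circle_measure UNIV = 1"
  by (subst emeasure_distr) (auto simp: space_restrict_space emeasure_restrict_space)

lemma product_sigma_finite_circle: "product_sigma_finite (\<lambda>j::'d::finite. circle_measure)"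
proof -
  interpret finite_measure circle_measure
    by (rule finite_measureI) (use emeasure_circle_UNIV in simp)
  show ?thesis
    by unfold_locales
qed

text \<open>Identifying the product sigma-algebra with the Borel sets of the product topology makes
  continuous functions measurable and lets the uniqueness proof start from closed sets.\<close>

lemma sets_haar_torus [measurable_cong, simp]:
  "sets (haar_torus :: ('d::finite \<Rightarrow> complex) measure) = sets borel"
proof -
  have "sets (haar_torus :: ('d \<Rightarrow> complex) measure) = sets (Pi\<^sub>M UNIV (\<lambda>j::'d. borel :: complex measure))"
    unfolding haar_torus_def by (rule sets_PiM_cong) auto
  then show ?thesis
    using sets_PiM_equal_borel by simp
qed

lemma space_haar_torus [simp]: "space (haar_torus :: ('d::finite \<Rightarrow> complex) measure) = UNIV"
  using sets_eq_imp_space_eq[OF sets_haar_torus] by simp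

lemma emeasure_haar_torus_box:
  assumes "\<And>j. A j \<in> sets borel"
  shows "emeasure haar_torus (Pi\<^sub>E (UNIV::'d::finite set) A) = (\<Prod>j\<in>UNIV. emeasure circle_measure (A j))"
  unfolding haar_torus_def using assms
  by (intro product_sigma_finite.emeasure_PiM[OF product_sigma_finite_circle]) auto

lemma emeasure_haar_torus_UNIV: "emeasure haar_torus (UNIV :: ('d::finite \<Rightarrow> complex) set) = 1"
  using emeasure_haar_torus_box[of "\<lambda>j::'d. UNIV"] emeasure_circle_UNIV by simp

text \<open>The torus is the box of unit circles, whose measure is a product of ones and hence
  equals the total mass.\<close>

lemma AE_haar_torus: "AE z in haar_torus. z \<in> (torus :: ('d::finite \<Rightarrow> complex) set)"
proof -
  have *: "(torus :: ('d \<Rightarrow> complex) set) = Pi\<^sub>E UNIV (\<lambda>_. sphere 0 1)"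
    by (auto simp: torus_def)
  have 1: "emeasure haar_torus (torus :: ('d \<Rightarrow> complex) set) = 1"
    unfolding * by (subst emeasure_haar_torus_box) (auto simp: emeasure_circle_sphere)
  then have m: "(torus :: ('d \<Rightarrow> complex) set) \<in> sets haar_torus"
    using emeasure_notin_sets by fastforce
  interpret finite_measure "haar_torus :: ('d \<Rightarrow> complex) measure"
    by (rule finite_measureI) (simp add: emeasure_haar_torus_UNIV)
  have "emeasure haar_torus (UNIV - torus :: ('d \<Rightarrow> complex) set) = 0"
    using emeasure_compl[OF m] 1 by (simp add: emeasure_haar_torus_UNIV)
  then show ?thesis
    using m by (intro AE_I[where N = "UNIV - torus"]) (auto simp del: sets_haar_torus)
qed

interpretation haar: finite_measure "haar_torus :: ('d::finite \<Rightarrow> complex) measure"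
  by (rule finite_measureI) (simp add: emeasure_haar_torus_UNIV)

lemma haar_prob: "measure haar_torus (UNIV :: ('d::finite \<Rightarrow> complex) set) = 1"
  by (simp add: measure_def emeasure_haar_torus_UNIV)

section \<open>Characters: measurability, algebra and orthogonality\<close>

lemma measurable_coord [measurable]: "(\<lambda>z::'d::finite \<Rightarrow> complex. z j) \<in> borel_measurable haar_torus"
  by (subst measurable_cong_sets[OF sets_haar_torus refl])
    (auto intro!: borel_measurable_continuous_onI)

lemma measurable_torus_pow [measurable]:
  "(\<lambda>z::'d::finite \<Rightarrow> complex. torus_pow z x) \<in> borel_measurable haar_torus"
  unfolding torus_pow_def by measurable

lemma torus_nonzero: "z \<in> torus \<Longrightarrow> z j \<noteq> 0"
  by (auto simp: torus_def dest: spec[of _ j])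

lemma norm_torus_pow: "z \<in> torus \<Longrightarrow> cmod (torus_pow z x) = 1"
  unfolding torus_pow_def torus_def prod_norm[symmetric] by (simp add: norm_power_int)

lemma torus_pow_nonzero: "z \<in> torus \<Longrightarrow> torus_pow z x \<noteq> 0"
  using norm_torus_pow[of z x] by auto

lemma torus_pow_add: "z \<in> torus \<Longrightarrow> torus_pow z (x + y) = torus_pow z x * torus_pow z y"
  by (simp add: torus_pow_def power_int_add torus_nonzero prod.distrib)

lemma torus_pow_0 [simp]: "torus_pow z 0 = 1"
  by (simp add: torus_pow_def)

lemma torus_pow_minus: "torus_pow z (- x) = inverse (torus_pow z x)"
  unfolding torus_pow_def prod_inversef[symmetric] o_def by (simp add: power_int_minus)

lemma cnj_torus_pow: "z \<in> torus \<Longrightarrow> cnj (torus_pow z x) = torus_pow z (- x)"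
  using norm_torus_pow[of z x] complex_norm_square[of "torus_pow z x"] torus_pow_nonzero[of z x]
  by (simp add: torus_pow_minus field_simps)

lemma torus_pow_axis: "torus_pow z (axis j n) = z j powi n"
proof -
  have "torus_pow z (axis j n) = (\<Prod>i\<in>UNIV. if i = j then z j powi n else 1)"
    unfolding torus_pow_def by (intro prod.cong) (auto simp: axis_def)
  then show ?thesis by simp
qed

lemma integral_circle_powi: "integral\<^sup>L circle_measure (\<lambda>u. u powi n) = (if n = 0 then 1 else 0)"
proof -
  have eq: "cis (2 * pi * t) powi n = cis (2 * pi * n * t)" for t
    by (simp add: cis_power_int mult_ac)
  have "integral\<^sup>L circle_measure (\<lambda>u. u powi n)
      = integral\<^sup>L lborel (\<lambda>t. indicator {0..1} t *\<^sub>R cis (2 * pi * n * t))"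
    by (subst integral_distr) (auto simp: integral_restrict_space eq)
  also have "\<dots> = (if n = 0 then 1 else 0)"
  proof (cases "n = 0")
    case False
    \<comment> \<open>An antiderivative for nonzero \<open>n\<close>; it takes the same value at 0
      and 1 because \<open>n\<close> is an integer.\<close>
    define F where "F t = cis (2 * pi * n * t) / (2 * pi * n * \<i>)" for t :: real
    have "integral\<^sup>L lborel (\<lambda>t. indicator {0..1} t *\<^sub>R cis (2 * pi * n * t)) = F 1 - F 0"
    proof (rule integral_FTC_atLeastAtMost)
      fix t :: real
      have "((\<lambda>t. exp (\<i> * (2 * pi * n) * of_real t) / (2 * pi * n * \<i>)) has_vector_derivative exp (\<i> * (2 * pi * n) * of_real t)) (at t within {0..1})"
        using False by (auto intro!: derivative_eq_intros has_vector_derivative_real_field simp: field_simps)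
      then show "(F has_vector_derivative cis (2 * pi * n * t)) (at t within {0..1})"
        unfolding F_def by (simp add: cis_conv_exp mult_ac)
    qed (auto intro!: continuous_intros)
    also have "\<dots> = 0"
      using cis_multiple_2pi[of "real_of_int n"] by (simp add: F_def mult_ac)
    finally show ?thesis using False by simp
  qed auto
  finally show ?thesis .
qed

text \<open>A character is a product of functions of single coordinates, so its integral factors
  into circle integrals, one of which vanishes unless every exponent is 0.\<close>

lemma integral_torus_pow: "integral\<^sup>L haar_torus (\<lambda>z. torus_pow z x) = (if x = (0::int^'d::finite) then 1 else 0)"
proof -
  have "AE u in circle_measure. cmod u = 1"
  proof -
    have "AE t in restrict_space lborel {0..1::real}. cmod (cis (2 * pi * t)) = 1"
      by auto
    then show ?thesis by (subst AE_distr_iff) auto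
  qed
  then have "integrable circle_measure (\<lambda>u. u powi (x $ j))" for j
    by (intro finite_measure.integrable_const_bound[where B = 1] finite_measureI)
       (auto simp: norm_power_int emeasure_circle_UNIV)
  then have "integral\<^sup>L haar_torus (\<lambda>z. torus_pow z x) = (\<Prod>j\<in>UNIV. integral\<^sup>L circle_measure (\<lambda>u. u powi (x $ j)))"
    unfolding torus_pow_def haar_torus_def
    by (intro product_sigma_finite.product_integral_prod[OF product_sigma_finite_circle]) auto
  also have "\<dots> = (\<Prod>j\<in>UNIV. if x $ j = 0 then 1 else 0)"
    by (simp add: integral_circle_powi)
  also have "\<dots> = (if x = 0 then 1 else 0)"
    by (auto simp: vec_eq_iff)
  finally show ?thesis .
qed

section \<open>Fourier coefficients of square integrable functions\<close>

lemma measurable_cnj [measurable]: "cnj \<in> borel_measurable borel"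
  by (intro borel_measurable_continuous_onI continuous_intros)

lemma of_real_cmod_square: "(complex_of_real (cmod z))\<^sup>2 = z * cnj z"
  by (metis complex_norm_square of_real_power)

text \<open>The scalar counterpart of \<open>inv_fourier\<close>; vector valued functions are
  treated component by component.\<close>

definition fcoef :: "(('d::finite \<Rightarrow> complex) \<Rightarrow> complex) \<Rightarrow> int^'d \<Rightarrow> complex" where
  "fcoef h x = integral\<^sup>L haar_torus (\<lambda>z. torus_pow z (- x) * h z)"

definition square_integrable :: "(('d::finite \<Rightarrow> complex) \<Rightarrow> complex) \<Rightarrow> bool" where
  "square_integrable h \<longleftrightarrow>
     h \<in> borel_measurable haar_torus \<and> integrable haar_torus (\<lambda>z. (cmod (h z))\<^sup>2)"

lemma square_integrable_measurable [measurable_dest]: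
  "square_integrable h \<Longrightarrow> h \<in> borel_measurable haar_torus"
  by (simp add: square_integrable_def)

lemma square_integrable_mult:
  assumes "square_integrable h" "square_integrable k"
  shows "integrable haar_torus (\<lambda>z. h z * k z)"
proof (rule Bochner_Integration.integrable_bound)
  show "integrable haar_torus (\<lambda>z. (cmod (h z))\<^sup>2 + (cmod (k z))\<^sup>2)"
    using assms by (auto simp: square_integrable_def)
  have "a * b \<le> a\<^sup>2 + b\<^sup>2" if "0 \<le> a" "0 \<le> b" for a b :: real
    using sum_squares_bound[of a b] mult_nonneg_nonneg[OF that] by linarith
  then show "AE z in haar_torus. norm (h z * k z) \<le> norm ((cmod (h z))\<^sup>2 + (cmod (k z))\<^sup>2)"
    by (auto simp: norm_mult)
qed (use assms in measurable)

lemma square_integrable_bounded: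
  assumes "h \<in> borel_measurable haar_torus" "AE z in haar_torus. cmod (h z) \<le> B"
  shows "square_integrable h"
  unfolding square_integrable_def
proof
  show "integrable haar_torus (\<lambda>z. (cmod (h z))\<^sup>2)"
  proof (rule haar.integrable_const_bound[where B = "B\<^sup>2"])
    show "AE z in haar_torus. norm ((cmod (h z))\<^sup>2) \<le> B\<^sup>2"
      using assms(2) by eventually_elim (simp add: power_mono)
  qed (use assms(1) in measurable)
qed fact

lemma square_integrable_mult_bounded:
  assumes "square_integrable h" "k \<in> borel_measurable haar_torus" "AE z in haar_torus. cmod (k z) \<le> B"
  shows "square_integrable (\<lambda>z. h z * k z)"
proof -
  have [measurable]: "h \<in> borel_measurable haar_torus" "k \<in> borel_measurable haar_torus"
    using assms by (auto simp: square_integrable_def)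
  have "integrable haar_torus (\<lambda>z. (cmod (h z * k z))\<^sup>2)"
  proof (rule Bochner_Integration.integrable_bound)
    show "integrable haar_torus (\<lambda>z. B\<^sup>2 * (cmod (h z))\<^sup>2)"
      using assms(1) by (auto simp: square_integrable_def)
    show "AE z in haar_torus. norm ((cmod (h z * k z))\<^sup>2) \<le> norm (B\<^sup>2 * (cmod (h z))\<^sup>2)"
      using assms(3)
    proof eventually_elim
      case (elim z)
      then have "(cmod (k z))\<^sup>2 \<le> B\<^sup>2" by (intro power_mono) auto
      then show ?case
        using mult_left_mono[of "(cmod (k z))\<^sup>2" "B\<^sup>2" "(cmod (h z))\<^sup>2"]
        by (simp add: norm_mult power_mult_distrib mult.commute)
    qed
  qed measurable
  then show ?thesis by (simp add: square_integrable_def)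
qed

lemma square_integrable_torus_pow: "square_integrable (\<lambda>z. torus_pow z x)"
  using AE_haar_torus by (intro square_integrable_bounded[where B = 1]) (auto simp: norm_torus_pow)

lemma square_integrable_const: "square_integrable (\<lambda>z. c)"
  by (intro square_integrable_bounded[where B = "cmod c"]) auto

lemma square_integrable_cnj: "square_integrable h \<Longrightarrow> square_integrable (\<lambda>z. cnj (h z))"
  by (auto simp: square_integrable_def)

lemma square_integrable_cmult: "square_integrable h \<Longrightarrow> square_integrable (\<lambda>z. c * h z)"
  using square_integrable_mult_bounded[of h "\<lambda>_. c" "cmod c"] by (simp add: mult.commute)

lemma square_integrable_add:
  assumes "square_integrable h" "square_integrable k"
  shows "square_integrable (\<lambda>z. h z + k z)"
proof -
  have [measurable]: "h \<in> borel_measurable haar_torus" "k \<in> borel_measurable haar_torus"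
    using assms by (auto simp: square_integrable_def)
  have "integrable haar_torus (\<lambda>z. (cmod (h z + k z))\<^sup>2)"
  proof (rule Bochner_Integration.integrable_bound)
    show "integrable haar_torus (\<lambda>z. 2 * (cmod (h z))\<^sup>2 + 2 * (cmod (k z))\<^sup>2)"
      using assms by (auto simp: square_integrable_def)
    have "(cmod (a + b))\<^sup>2 \<le> 2 * (cmod a)\<^sup>2 + 2 * (cmod b)\<^sup>2" for a b
    proof -
      have "(cmod (a + b))\<^sup>2 \<le> (cmod a + cmod b)\<^sup>2"
        by (intro power_mono norm_triangle_ineq) auto
      also have "\<dots> \<le> 2 * (cmod a)\<^sup>2 + 2 * (cmod b)\<^sup>2"
        using sum_squares_bound[of "cmod a" "cmod b"] by (simp add: power2_sum)
      finally show ?thesis .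
    qed
    then show "AE z in haar_torus. norm ((cmod (h z + k z))\<^sup>2) \<le> norm (2 * (cmod (h z))\<^sup>2 + 2 * (cmod (k z))\<^sup>2)"
      by auto
  qed measurable
  then show ?thesis by (simp add: square_integrable_def)
qed

lemma square_integrable_sum:
  "(\<And>i. i \<in> I \<Longrightarrow> square_integrable (h i)) \<Longrightarrow> square_integrable (\<lambda>z. \<Sum>i\<in>I. h i z)"
  by (induction I rule: infinite_finite_induct)
     (auto intro: square_integrable_add square_integrable_const)

lemma square_integrable_integrable:
  "square_integrable h \<Longrightarrow> integrable haar_torus h"
  using square_integrable_mult[OF _ square_integrable_const[of 1], of h] by simp

lemma fcoef_cong_AE:
  assumes "h \<in> borel_measurable haar_torus" "k \<in> borel_measurable haar_torus" "AE z in haar_torus. h z = k z"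
  shows "fcoef h = fcoef k"
  unfolding fcoef_def using assms by (intro ext integral_cong_AE) auto

lemma integrable_torus_pow_mult:
  assumes "integrable haar_torus h"
  shows "integrable haar_torus (\<lambda>z. torus_pow z x * h z)"
proof (rule Bochner_Integration.integrable_bound[OF assms])
  show "AE z in haar_torus. norm (torus_pow z x * h z) \<le> norm (h z)"
    using AE_haar_torus by eventually_elim (simp add: norm_mult norm_torus_pow)
qed (use assms in measurable)

text \<open>By this rule the shifts of the walk become multiplication by characters.\<close>

lemma fcoef_torus_pow_mult:
  assumes [measurable]: "h \<in> borel_measurable haar_torus"
  shows "fcoef (\<lambda>z. torus_pow z y * h z) x = fcoef h (x - y)"
  unfolding fcoef_def
proof (rule integral_cong_AE)
  show "AE z in haar_torus. torus_pow z (- x) * (torus_pow z y * h z) = torus_pow z (- (x - y)) * h z"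
    using AE_haar_torus
  proof eventually_elim
    case (elim z)
    show ?case
      using torus_pow_add[OF elim, of "- x" y] by simp
  qed
qed measurable

lemma fcoef_add:
  "integrable haar_torus h \<Longrightarrow> integrable haar_torus k \<Longrightarrow> fcoef (\<lambda>z. h z + k z) x = fcoef h x + fcoef k x"
  unfolding fcoef_def by (simp add: distrib_left integrable_torus_pow_mult)

lemma fcoef_diff:
  "integrable haar_torus h \<Longrightarrow> integrable haar_torus k \<Longrightarrow> fcoef (\<lambda>z. h z - k z) x = fcoef h x - fcoef k x"
  unfolding fcoef_def by (simp add: right_diff_distrib integrable_torus_pow_mult)

lemma fcoef_cmult: "fcoef (\<lambda>z. c * h z) x = c * fcoef h x"
  unfolding fcoef_def by (simp add: mult.left_commute[of _ c])

lemma fcoef_sum: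
  "(\<And>i. i \<in> I \<Longrightarrow> integrable haar_torus (h i)) \<Longrightarrow> fcoef (\<lambda>z. \<Sum>i\<in>I. h i z) x = (\<Sum>i\<in>I. fcoef (h i) x)"
  unfolding fcoef_def by (simp add: sum_distrib_left integrable_torus_pow_mult)

lemma fcoef_cnj: 
  assumes "h \<in> borel_measurable haar_torus"
  shows "fcoef (\<lambda>z. cnj (h z)) x = cnj (fcoef h (- x))"
proof -
  have "fcoef (\<lambda>z. cnj (h z)) x = integral\<^sup>L haar_torus (\<lambda>z. cnj (torus_pow z x * h z))"
    unfolding fcoef_def
  proof (rule integral_cong_AE)
    show "AE z in haar_torus. torus_pow z (- x) * cnj (h z) = cnj (torus_pow z x * h z)"
      using AE_haar_torus by eventually_elim (simp add: cnj_torus_pow)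
  qed (use assms in measurable)
  then show ?thesis by (simp only: fcoef_def Bochner_Integration.integral_cnj minus_minus)
qed

section \<open>Trigonometric polynomials and Bessel's inequality\<close>

definition trig :: "(int^'d) set \<Rightarrow> (int^'d \<Rightarrow> complex) \<Rightarrow> ('d::finite \<Rightarrow> complex) \<Rightarrow> complex" where
  "trig A c z = (\<Sum>x\<in>A. c x * torus_pow z x)"

lemma square_integrable_trig: "square_integrable (trig A c)"
  unfolding trig_def
  by (intro square_integrable_sum square_integrable_cmult square_integrable_torus_pow)

lemma fcoef_torus_pow: "fcoef (\<lambda>z. torus_pow z y) x = (if x = y then 1 else 0)"
  using fcoef_torus_pow_mult[of "\<lambda>_. 1" y x] integral_torus_pow[of "y - x"] by (simp add: fcoef_def)

lemma fcoef_trig: "finite A \<Longrightarrow> fcoef (trig A c) x = (if x \<in> A then c x else 0)"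
  unfolding trig_def
  by (subst fcoef_sum)
     (auto simp: fcoef_cmult fcoef_torus_pow if_distrib sum.delta' cong: if_cong
       intro!: square_integrable_integrable square_integrable_cmult square_integrable_torus_pow)

lemma integral_mult_cnj_trig:
  assumes "square_integrable h"
  shows "integral\<^sup>L haar_torus (\<lambda>z. h z * cnj (trig A c z)) = (\<Sum>x\<in>A. cnj (c x) * fcoef h x)"
proof -
  note [measurable] = square_integrable_measurable[OF assms]
  have "integral\<^sup>L haar_torus (\<lambda>z. h z * cnj (trig A c z))
      = integral\<^sup>L haar_torus (\<lambda>z. \<Sum>x\<in>A. cnj (c x) * (torus_pow z (- x) * h z))"
  proof (rule integral_cong_AE)
    show "AE z in haar_torus. h z * cnj (trig A c z) = (\<Sum>x\<in>A. cnj (c x) * (torus_pow z (- x) * h z))"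
      using AE_haar_torus
      by eventually_elim (simp add: trig_def cnj_torus_pow sum_distrib_left mult_ac)
  qed (simp_all add: trig_def)
  also have "\<dots> = (\<Sum>x\<in>A. cnj (c x) * fcoef h x)"
    using integrable_torus_pow_mult[OF square_integrable_integrable[OF assms]]
    by (simp add: fcoef_def)
  finally show ?thesis .
qed

lemma integral_norm_trig:
  assumes "finite A"
  shows "integral\<^sup>L haar_torus (\<lambda>z. (cmod (trig A c z))\<^sup>2) = (\<Sum>x\<in>A. (cmod (c x))\<^sup>2)"
proof -
  have "of_real (integral\<^sup>L haar_torus (\<lambda>z. (cmod (trig A c z))\<^sup>2)) = integral\<^sup>L haar_torus (\<lambda>z. trig A c z * cnj (trig A c z))"
    by (simp add: of_real_cmod_square flip: integral_complex_of_real)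
  also have "\<dots> = of_real (\<Sum>x\<in>A. (cmod (c x))\<^sup>2)"
    using assms by (simp add: integral_mult_cnj_trig[OF square_integrable_trig] fcoef_trig of_real_cmod_square mult.commute)
  finally show ?thesis
    using of_real_eq_iff by blast
qed

text \<open>The squared norm of \<open>h - s\<close>, with \<open>s\<close> the partial Fourier sum
  over \<open>A\<close>, is nonnegative. Both cross terms and the squared norm of \<open>s\<close>
  equal the sum of the squared coefficients, so the expansion leaves the squared norm of
  \<open>h\<close> minus that sum.\<close>

lemma bessel:
  assumes h: "square_integrable h" and "finite A"
  shows "(\<Sum>x\<in>A. (cmod (fcoef h x))\<^sup>2) \<le> integral\<^sup>L haar_torus (\<lambda>z. (cmod (h z))\<^sup>2)"
proof -
  define s where "s = trig A (fcoef h)"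
  let ?B = "\<Sum>x\<in>A. (cmod (fcoef h x))\<^sup>2"
  have s: "square_integrable s" by (simp add: s_def square_integrable_trig)
  have hs: "integral\<^sup>L haar_torus (\<lambda>z. h z * cnj (s z)) = of_real ?B"
    by (simp add: s_def integral_mult_cnj_trig[OF h] of_real_cmod_square mult.commute)
  have sh: "integral\<^sup>L haar_torus (\<lambda>z. s z * cnj (h z)) = of_real ?B"
  proof -
    have "(\<lambda>z. s z * cnj (h z)) = (\<lambda>z. cnj (h z * cnj (s z)))"
      by (simp add: mult.commute)
    then show ?thesis by (simp only: Bochner_Integration.integral_cnj hs complex_cnj_complex_of_real)
  qed
  have ss: "integral\<^sup>L haar_torus (\<lambda>z. s z * cnj (s z)) = of_real ?B"
    by (simp add: s_def integral_mult_cnj_trig[OF square_integrable_trig] fcoef_trig assms of_real_cmod_square mult.commute)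
  have hh: "integral\<^sup>L haar_torus (\<lambda>z. h z * cnj (h z)) = of_real (integral\<^sup>L haar_torus (\<lambda>z. (cmod (h z))\<^sup>2))"
    by (simp add: of_real_cmod_square flip: integral_complex_of_real)
  have "of_real (integral\<^sup>L haar_torus (\<lambda>z. (cmod (h z - s z))\<^sup>2))
      = integral\<^sup>L haar_torus (\<lambda>z. (h z - s z) * cnj (h z - s z))"
    by (simp add: of_real_cmod_square flip: integral_complex_of_real)
  also have "\<dots> = integral\<^sup>L haar_torus (\<lambda>z. h z * cnj (h z) - h z * cnj (s z) - s z * cnj (h z) + s z * cnj (s z))"
    by (simp add: algebra_simps)
  also have "\<dots> = of_real (integral\<^sup>L haar_torus (\<lambda>z. (cmod (h z))\<^sup>2)) - of_real ?B"
    using h s by (simp add: square_integrable_mult square_integrable_cnj hh hs sh ss)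
  finally have "integral\<^sup>L haar_torus (\<lambda>z. (cmod (h z - s z))\<^sup>2) = integral\<^sup>L haar_torus (\<lambda>z. (cmod (h z))\<^sup>2) - ?B"
    unfolding of_real_diff[symmetric] of_real_eq_iff .
  moreover have "0 \<le> integral\<^sup>L haar_torus (\<lambda>z. (cmod (h z - s z))\<^sup>2)"
    by simp
  ultimately show ?thesis by linarith
qed

lemma l2s_fcoef: 
  assumes "square_integrable h"
  shows "l2s (fcoef h)"
  unfolding l2s_def
  by (rule nonneg_bdd_above_summable_on) (auto intro!: bdd_aboveI2 bessel assms)

lemma infsum_fcoef_le:
  assumes "square_integrable h"
  shows "(\<Sum>\<^sub>\<infinity>x. (cmod (fcoef h x))\<^sup>2) \<le> integral\<^sup>L haar_torus (\<lambda>z. (cmod (h z))\<^sup>2)"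
  using l2s_fcoef[OF assms] by (intro infsum_le_finite_sums) (auto simp: l2s_def intro: bessel assms)

text \<open>If \<open>g\<close> is the indicator of \<open>{z. z\<^sup>\<alpha> = - 1}\<close>, then \<open>z\<^sup>\<alpha> g = - g\<close>, so the modulus of the
  Fourier coefficients of \<open>g\<close> is constant along \<open>\<alpha>\<close>, which Bessel's inequality only allows
  if they vanish.\<close>
lemma AE_torus_pow_neq_minus_1: "AE z in haar_torus. torus_pow z (\<alpha>::int^'d::finite) \<noteq> - 1"
proof (cases "\<alpha> = 0")
  case False
  define g :: "('d \<Rightarrow> complex) \<Rightarrow> complex" where "g z = (if torus_pow z \<alpha> = - 1 then 1 else 0)" for z
  have [measurable]: "g \<in> borel_measurable haar_torus"
    unfolding g_def by measurable
  have g: "square_integrable g"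
    by (rule square_integrable_bounded[where B = 1]) (auto simp: g_def)
  have step: "fcoef g (x - \<alpha>) = - fcoef g x" for x
  proof -
    have "fcoef g (x - \<alpha>) = fcoef (\<lambda>z. torus_pow z \<alpha> * g z) x"
      by (simp add: fcoef_torus_pow_mult)
    also have "(\<lambda>z. torus_pow z \<alpha> * g z) = (\<lambda>z. - 1 * g z)"
      by (auto simp: g_def)
    also have "fcoef \<dots> x = - fcoef g x"
      by (subst fcoef_cmult) simp
    finally show ?thesis .
  qed
  define a where "a n = - (\<chi> j. int n * \<alpha> $ j)" for n
  have a: "a (Suc n) = a n - \<alpha>" for n
    by (simp add: a_def vec_eq_iff algebra_simps)
  have c: "cmod (fcoef g (a n)) = cmod (fcoef g 0)" for n
  proof (induction n)
    case 0
    have "a 0 = 0" by (simp add: a_def vec_eq_iff)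
    then show ?case by simp
  next
    case (Suc n)
    then show ?case by (simp add: a step)
  qed
  obtain j where "\<alpha> $ j \<noteq> 0" using False by (auto simp: vec_eq_iff)
  then have inj: "inj a" by (auto simp: inj_def a_def vec_eq_iff)
  have "real N * (cmod (fcoef g 0))\<^sup>2 \<le> integral\<^sup>L haar_torus (\<lambda>z. (cmod (g z))\<^sup>2)" for N
  proof -
    have "(\<Sum>x\<in>a ` {..<N}. (cmod (fcoef g x))\<^sup>2) = (\<Sum>n<N. (cmod (fcoef g (a n)))\<^sup>2)"
      using inj by (subst sum.reindex) (auto simp: inj_on_def inj_def)
    then show ?thesis
      using bessel[OF g, of "a ` {..<N}"] by (simp add: c)
  qed
  then have "fcoef g 0 = 0"
    using reals_Archimedean3[of "(cmod (fcoef g 0))\<^sup>2"] by (metis not_less zero_less_norm_iff zero_less_power)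
  then have "integral\<^sup>L haar_torus g = 0"
    by (simp add: fcoef_def)
  \<comment> \<open>An indicator is its own modulus, so its zero mean forces it to vanish almost
    everywhere.\<close>
  also have "integral\<^sup>L haar_torus g = of_real (integral\<^sup>L haar_torus (\<lambda>z. cmod (g z)))"
  proof -
    have "g = (\<lambda>z. of_real (cmod (g z)))" by (auto simp: g_def)
    then have "integral\<^sup>L haar_torus g = integral\<^sup>L haar_torus (\<lambda>z. complex_of_real (cmod (g z)))"
      by (rule arg_cong)
    then show ?thesis by (simp only: integral_complex_of_real)
  qed
  finally have "integral\<^sup>L haar_torus (\<lambda>z. cmod (g z)) = 0" by simp
  then have "AE z in haar_torus. cmod (g z) = 0"
    by (subst (asm) integral_nonneg_eq_0_iff_AE) (auto intro: square_integrable_integrable g)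
  then show ?thesis
    by eventually_elim (auto simp: g_def split: if_splits)
qed simp

section \<open>Uniqueness of Fourier coefficients\<close>

text \<open>The annihilator of the characters, taken in L^1. Uniqueness says that it contains only
  functions vanishing almost everywhere.\<close>

definition fcoef_zero :: "(('d::finite \<Rightarrow> complex) \<Rightarrow> complex) \<Rightarrow> bool" where
  "fcoef_zero h \<longleftrightarrow> integrable haar_torus h \<and> (\<forall>x. fcoef h x = 0)"

lemma fcoef_zero_integrable: "fcoef_zero h \<Longrightarrow> integrable haar_torus h"
  by (simp add: fcoef_zero_def)

lemma fcoef_zero_integral:
  assumes "fcoef_zero h"
  shows "integral\<^sup>L haar_torus h = 0"
proof -
  have "fcoef h 0 = 0" using assms unfolding fcoef_zero_def by blast
  then show ?thesis by (simp add: fcoef_def)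
qed

lemma fcoef_zero_add: "fcoef_zero h \<Longrightarrow> fcoef_zero k \<Longrightarrow> fcoef_zero (\<lambda>z. h z + k z)"
  by (simp add: fcoef_zero_def fcoef_add)

lemma fcoef_zero_cmult: "fcoef_zero h \<Longrightarrow> fcoef_zero (\<lambda>z. c * h z)"
  by (simp add: fcoef_zero_def fcoef_cmult)

lemma fcoef_zero_torus_pow_mult: "fcoef_zero h \<Longrightarrow> fcoef_zero (\<lambda>z. torus_pow z x * h z)"
  by (simp add: fcoef_zero_def fcoef_torus_pow_mult[OF borel_measurable_integrable] integrable_torus_pow_mult)

lemma fcoef_zero_cong_AE:
  assumes "fcoef_zero h" "k \<in> borel_measurable haar_torus" "AE z in haar_torus. h z = k z"
  shows "fcoef_zero k"
proof -
  have "integrable haar_torus k"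
    by (rule integrable_cong_AE_imp[OF fcoef_zero_integrable[OF assms(1)] assms(2,3)])
  moreover have "fcoef k = fcoef h"
    using fcoef_cong_AE[OF borel_measurable_integrable[OF fcoef_zero_integrable[OF assms(1)]] assms(2,3)] by (rule sym)
  ultimately show ?thesis using assms(1) by (simp add: fcoef_zero_def)
qed

section \<open>From characters to continuous functions to Borel sets\<close>

lemma compact_torus: "compact (torus :: ('d::finite \<Rightarrow> complex) set)"
proof -
  have "(torus :: ('d \<Rightarrow> complex) set) = Pi\<^sub>E UNIV (\<lambda>_. sphere 0 1)"
    by (auto simp: torus_def)
  moreover have "compactin (product_topology (\<lambda>i::'d. euclidean) UNIV) (Pi\<^sub>E UNIV (\<lambda>_. sphere (0::complex) 1))"
    by (subst compactin_PiE) auto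
  ultimately show ?thesis
    by (simp add: euclidean_product_topology)
qed

text \<open>The continuous multipliers that preserve vanishing of all Fourier coefficients: as multipliers
  they are closed under products for free, so Stone--Weierstrass applies without any computation
  with trigonometric polynomials.\<close>
definition coef_multipliers :: "(('d::finite \<Rightarrow> complex) \<Rightarrow> real) set" where
  "coef_multipliers = {f. continuous_on UNIV f \<and> (\<forall>h. fcoef_zero h \<longrightarrow> fcoef_zero (\<lambda>z. of_real (f z) * h z))}"

text \<open>On the torus the conjugate of \<open>z j\<close> is its inverse, so the real part is
  half the sum of two characters, and multiplication by a character merely shifts the
  coefficients.\<close>

lemma Re_coord_coef_multipliers: "(\<lambda>z. Re (z (j::'d::finite))) \<in> coef_multipliers"
  unfolding coef_multipliers_def
proof (intro CollectI conjI allI impI)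
  fix h :: "('d \<Rightarrow> complex) \<Rightarrow> complex" assume h: "fcoef_zero h"
  note [measurable] = borel_measurable_integrable[OF fcoef_zero_integrable[OF h]]
  show "fcoef_zero (\<lambda>z. of_real (Re (z j)) * h z)"
  proof (rule fcoef_zero_cong_AE)
    show "fcoef_zero (\<lambda>z. 1/2 * (torus_pow z (axis j 1) * h z + torus_pow z (- axis j 1) * h z))"
      by (intro fcoef_zero_cmult fcoef_zero_add fcoef_zero_torus_pow_mult h)
    show "AE z in haar_torus. 1/2 * (torus_pow z (axis j 1) * h z + torus_pow z (- axis j 1) * h z) = of_real (Re (z j)) * h z"
      using AE_haar_torus
    proof eventually_elim
      case (elim z)
      have "z j + cnj (z j) = 2 * of_real (Re (z j))"
        by (simp add: complex_add_cnj)
      then show ?case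
        using elim by (simp flip: cnj_torus_pow distrib_right add: torus_pow_axis)
    qed
  qed measurable
qed (intro continuous_intros continuous_on_product_coordinates)

text \<open>The same two characters, now subtracted. Together with the real parts these functions
  separate the points of the torus, as Stone--Weierstrass requires.\<close>

lemma Im_coord_coef_multipliers: "(\<lambda>z. Im (z (j::'d::finite))) \<in> coef_multipliers"
  unfolding coef_multipliers_def
proof (intro CollectI conjI allI impI)
  fix h :: "('d \<Rightarrow> complex) \<Rightarrow> complex" assume h: "fcoef_zero h"
  note [measurable] = borel_measurable_integrable[OF fcoef_zero_integrable[OF h]]
  show "fcoef_zero (\<lambda>z. of_real (Im (z j)) * h z)"
  proof (rule fcoef_zero_cong_AE)
    show "fcoef_zero (\<lambda>z. 1/(2*\<i>) * (torus_pow z (axis j 1) * h z + - 1 * (torus_pow z (- axis j 1) * h z)))"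
      by (intro fcoef_zero_cmult fcoef_zero_add fcoef_zero_torus_pow_mult h)
    show "AE z in haar_torus. 1/(2*\<i>) * (torus_pow z (axis j 1) * h z + - 1 * (torus_pow z (- axis j 1) * h z)) = of_real (Im (z j)) * h z"
      using AE_haar_torus
    proof eventually_elim
      case (elim z)
      have "z j - cnj (z j) = 2 * \<i> * of_real (Im (z j))"
        by (simp add: complex_eq_iff)
      then show ?case
        using elim by (simp flip: cnj_torus_pow left_diff_distrib add: torus_pow_axis)
    qed
  qed measurable
qed (intro continuous_intros continuous_on_product_coordinates)

lemma coef_multipliersD:
  assumes "f \<in> coef_multipliers"
  shows "continuous_on UNIV f" "fcoef_zero h \<Longrightarrow> fcoef_zero (\<lambda>z. of_real (f z) * h z)"
  using assms unfolding coef_multipliers_def by blast+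

lemma coef_multipliersI:
  assumes "continuous_on UNIV f" "\<And>h. fcoef_zero h \<Longrightarrow> fcoef_zero (\<lambda>z. of_real (f z) * h z)"
  shows "f \<in> coef_multipliers"
  using assms unfolding coef_multipliers_def by blast

lemma function_ring_coef_multipliers: "function_ring_on (coef_multipliers :: (('d::finite \<Rightarrow> complex) \<Rightarrow> real) set) torus"
proof
  fix f g :: "('d \<Rightarrow> complex) \<Rightarrow> real" assume fg: "f \<in> coef_multipliers" "g \<in> coef_multipliers"
  show "(\<lambda>z. f z + g z) \<in> coef_multipliers"
  proof (rule coef_multipliersI)
    fix h :: "('d \<Rightarrow> complex) \<Rightarrow> complex" assume h: "fcoef_zero h"
    show "fcoef_zero (\<lambda>z. of_real (f z + g z) * h z)"
      unfolding of_real_add distrib_right by (intro fcoef_zero_add coef_multipliersD(2) fg h)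
  qed (intro continuous_on_add coef_multipliersD(1) fg)
  show "(\<lambda>z. f z * g z) \<in> coef_multipliers"
  proof (rule coef_multipliersI)
    fix h :: "('d \<Rightarrow> complex) \<Rightarrow> complex" assume h: "fcoef_zero h"
    show "fcoef_zero (\<lambda>z. of_real (f z * g z) * h z)"
      using coef_multipliersD(2)[OF fg(1) coef_multipliersD(2)[OF fg(2) h]] by (simp only: of_real_mult mult.assoc)
  qed (intro continuous_on_mult coef_multipliersD(1) fg)
next
  fix x y :: "'d \<Rightarrow> complex" assume "x \<noteq> y"
  then obtain j where "x j \<noteq> y j" by auto
  then have "Re (x j) \<noteq> Re (y j) \<or> Im (x j) \<noteq> Im (y j)"
    by (simp add: complex_eq_iff)
  then show "\<exists>f\<in>coef_multipliers. f x \<noteq> f y"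
    using Re_coord_coef_multipliers[of j] Im_coord_coef_multipliers[of j] by (elim disjE) (rule bexI, assumption+)+
next
  fix f :: "('d \<Rightarrow> complex) \<Rightarrow> real" assume "f \<in> coef_multipliers"
  then show "continuous_on torus f"
    by (rule continuous_on_subset[OF coef_multipliersD(1) subset_UNIV])
next
  fix c show "(\<lambda>_::'d \<Rightarrow> complex. c) \<in> coef_multipliers"
    by (intro coef_multipliersI continuous_on_const fcoef_zero_cmult)
qed (rule compact_torus)

text \<open>A multiplier \<open>g\<close> within \<open>e\<close> of \<open>f\<close> on the torus
  satisfies \<open>integral\<^sup>L haar_torus (\<lambda>z. g z * h z) = 0\<close>, which bounds the
  integral of \<open>f * h\<close> by \<open>e\<close> times the L^1 norm of \<open>h\<close>. The
  global bound on \<open>f\<close> makes \<open>f * h\<close> integrable.\<close>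

lemma fcoef_zero_integral_continuous:
  fixes f :: "('d::finite \<Rightarrow> complex) \<Rightarrow> real" and h :: "('d \<Rightarrow> complex) \<Rightarrow> complex"
  assumes h: "fcoef_zero h" and f: "continuous_on UNIV f" and bd: "\<And>z. \<bar>f z\<bar> \<le> B"
  shows "integral\<^sup>L haar_torus (\<lambda>z. f z * h z) = 0"
proof -
  note hi = fcoef_zero_integrable[OF h]
  have [measurable]: "h \<in> borel_measurable haar_torus" using hi by auto
  have [measurable]: "f \<in> borel_measurable haar_torus"
    using f by (subst measurable_cong_sets[OF sets_haar_torus refl]) (rule borel_measurable_continuous_onI)
  have int_f: "integrable haar_torus (\<lambda>z. f z * h z)"
  proof (rule Bochner_Integration.integrable_bound)
    show "integrable haar_torus (\<lambda>z. B * cmod (h z))" using hi by auto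
    show "AE z in haar_torus. norm (f z * h z) \<le> norm (B * cmod (h z))"
      using bd abs_ge_self[of B] order_trans[OF bd] by (auto simp: norm_mult abs_mult intro!: mult_right_mono)
  qed measurable
  have le: "cmod (integral\<^sup>L haar_torus (\<lambda>z. f z * h z)) \<le> e * integral\<^sup>L haar_torus (\<lambda>z. cmod (h z))" if e: "e > 0" for e
  proof -
    have "continuous_on torus f"
      using f continuous_on_subset by blast
    then obtain g where g: "g \<in> coef_multipliers" "\<And>z. z \<in> torus \<Longrightarrow> \<bar>f z - g z\<bar> < e"
      using function_ring_on.Stone_Weierstrass_basic[OF function_ring_coef_multipliers _ e]
      by blast
    have gz: "fcoef_zero (\<lambda>z. g z * h z)" by (rule coef_multipliersD(2)[OF g(1) h])
    have "integral\<^sup>L haar_torus (\<lambda>z. f z * h z) = integral\<^sup>L haar_torus (\<lambda>z. f z * h z - g z * h z)"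
      using int_f fcoef_zero_integrable[OF gz] fcoef_zero_integral[OF gz] by simp
    also have "cmod \<dots> \<le> integral\<^sup>L haar_torus (\<lambda>z. cmod (f z * h z - g z * h z))"
      by (rule integral_norm_bound)
    also have "\<dots> \<le> integral\<^sup>L haar_torus (\<lambda>z. e * cmod (h z))"
    proof (rule integral_mono_AE)
      show "AE z in haar_torus. cmod (f z * h z - g z * h z) \<le> e * cmod (h z)"
        using AE_haar_torus
      proof eventually_elim
        case (elim z)
        then show ?case
          using g(2)[of z] by (simp add: norm_mult mult_right_mono less_imp_le flip: left_diff_distrib of_real_diff)
      qed
    qed (use int_f fcoef_zero_integrable[OF gz] hi in auto)
    finally show ?thesis by simp
  qed
  have "(\<lambda>n. inverse (real (Suc n)) * integral\<^sup>L haar_torus (\<lambda>z. cmod (h z))) \<longlonglongrightarrow> 0 * integral\<^sup>L haar_torus (\<lambda>z. cmod (h z))"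
    by (intro tendsto_intros LIMSEQ_inverse_real_of_nat)
  then have "cmod (integral\<^sup>L haar_torus (\<lambda>z. f z * h z)) \<le> 0"
    by (intro LIMSEQ_le_const[where X = "\<lambda>n. inverse (real (Suc n)) * integral\<^sup>L haar_torus (\<lambda>z. cmod (h z))"])
       (auto intro!: le)
  then show ?thesis by simp
qed

lemma fcoef_zero_integral_closed:
  fixes C :: "('d::finite \<Rightarrow> complex) set" and h :: "('d \<Rightarrow> complex) \<Rightarrow> complex"
  assumes h: "fcoef_zero h" and C: "closed C"
  shows "set_lebesgue_integral haar_torus C h = 0"
\<comment> \<open>The empty set is split off since \<open>infdist z {}\<close> is 0 by convention,
  which would make the cutoffs below constantly 1.\<close>
proof (cases "C = {}")
  case False
  \<comment> \<open>Continuous cutoffs decreasing to the indicator of \<open>C\<close>: they equal 1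
    on \<open>C\<close>, and a point outside has positive distance to the closed set
    \<open>C\<close>, so they vanish there for large \<open>n\<close>. Dominated convergence with
    majorant \<open>cmod (h z)\<close> applies.\<close>
  define f where "f n z = max 0 (1 - real n * infdist z C)" for n z
  have f: "continuous_on UNIV (f n)" for n
    unfolding f_def by (intro continuous_intros)
  have fb: "\<bar>f n z\<bar> \<le> 1" for n z
    using infdist_nonneg[of z C] by (auto simp: f_def max_def)
  have [measurable]: "f n \<in> borel_measurable haar_torus" for n
    using f by (subst measurable_cong_sets[OF sets_haar_torus refl]) (rule borel_measurable_continuous_onI)
  have [measurable]: "h \<in> borel_measurable haar_torus" "C \<in> sets haar_torus"
    using fcoef_zero_integrable[OF h] C by auto
  have "(\<lambda>n. integral\<^sup>L haar_torus (\<lambda>z. f n z * h z)) \<longlonglongrightarrow> integral\<^sup>L haar_torus (\<lambda>z. indicator C z *\<^sub>R h z)"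
  proof (rule integral_dominated_convergence)
    show "integrable haar_torus (\<lambda>z. cmod (h z))" using fcoef_zero_integrable[OF h] by simp
    show "AE z in haar_torus. norm (f n z * h z) \<le> cmod (h z)" for n
      using fb by (auto simp: norm_mult intro!: mult_left_le_one_le)
    have "(\<lambda>n. f n z) \<longlonglongrightarrow> indicator C z" for z
    proof (cases "z \<in> C")
      case True
      then have "f n z = 1" for n by (simp add: f_def)
      then show ?thesis using True by simp
    next
      case nC: False
      then have pos: "infdist z C > 0"
        using in_closed_iff_infdist_zero[OF C False] infdist_nonneg[of z C] by (metis order_less_le)
      obtain N where N: "1 / infdist z C < real N" using reals_Archimedean2 by blast
      have "f n z = 0" if "n \<ge> N" for n
      proof -
        have "1 / infdist z C \<le> real n" using N that by linarith
        then show ?thesis using pos by (simp add: f_def field_simps)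
      qed
      then have "\<forall>\<^sub>F n in sequentially. f n z = 0"
        by (auto simp: eventually_sequentially)
      then show ?thesis
        using nC by (simp add: tendsto_eventually)
    qed
    then show "AE z in haar_torus. (\<lambda>n. f n z * h z) \<longlonglongrightarrow> indicator C z *\<^sub>R h z"
      unfolding scaleR_conv_of_real by (auto intro!: tendsto_intros)
  qed measurable
  moreover have "integral\<^sup>L haar_torus (\<lambda>z. f n z * h z) = 0" for n
    by (rule fcoef_zero_integral_continuous[OF h f fb])
  ultimately show ?thesis
    by (simp add: set_lebesgue_integral_def LIMSEQ_const_iff)
qed (simp add: set_lebesgue_integral_def)

text \<open>An integrable function vanishes almost everywhere once its integral over every
  measurable set is 0. The sets with zero integral include the closed ones, which are stable under
  intersection and generate the Borel sets, and are stable under complements and countable disjoint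
  unions, so Dynkin's theorem yields all Borel sets.\<close>

lemma fcoef_zero_AE:
  fixes h :: "('d::finite \<Rightarrow> complex) \<Rightarrow> complex"
  assumes h: "fcoef_zero h"
  shows "AE z in haar_torus. h z = 0"
proof (rule haar.density_zero[OF fcoef_zero_integrable[OF h]])
  note hi = fcoef_zero_integrable[OF h]
  let ?I = "\<lambda>A. set_lebesgue_integral haar_torus A h"
  have sb: "sigma_sets UNIV (Collect closed) = sets (borel :: ('d \<Rightarrow> complex) measure)"
    by (simp add: borel_eq_closed)
  have si: "set_integrable haar_torus A h" if "A \<in> sets borel" for A
    using hi that integrable_mult_indicator[of A haar_torus h] by (simp add: set_integrable_def)
  fix A :: "('d \<Rightarrow> complex) set" assume "A \<in> sets haar_torus"
  then have "A \<in> sigma_sets UNIV (Collect closed)" by (simp add: sb)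
  have "Int_stable (Collect closed :: ('d \<Rightarrow> complex) set set)" "Collect closed \<subseteq> Pow (UNIV :: ('d \<Rightarrow> complex) set)"
    by (auto simp: Int_stable_def)
  from this \<open>A \<in> sigma_sets UNIV (Collect closed)\<close> show "?I A = 0"
  proof (induction A rule: sigma_sets_induct_disjoint)
    case (basic A)
    then show ?case using fcoef_zero_integral_closed[OF h] by simp
  next
    case (compl A)
    then have A: "A \<in> sets borel" by (simp add: sb)
    then have "UNIV - A \<in> sets borel" by auto
    then have "?I UNIV = ?I A + ?I (UNIV - A)"
      using set_integral_Un[of A "UNIV - A" haar_torus h] A by (simp add: si)
    then show ?case
      using compl fcoef_zero_integral[OF h] by (simp add: set_lebesgue_integral_def)
  next
    case (union A)
    then have "?I (\<Union>i. A i) = (\<Sum>i. ?I (A i))"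
      by (intro lebesgue_integral_countable_add) (auto simp: sb disjoint_family_on_def intro!: si)
    then show ?case using union by simp
  qed (simp add: set_lebesgue_integral_def)
qed

lemma fcoef_eq_imp_AE_eq:
  assumes "integrable haar_torus h" "integrable haar_torus k" "fcoef h = fcoef k"
  shows "AE z in haar_torus. h z = k z"
  using fcoef_zero_AE[of "\<lambda>z. h z - k z"] assms by (simp add: fcoef_zero_def fcoef_diff)

section \<open>Riesz--Fischer and Parseval\<close>

text \<open>A Cauchy--Schwarz bound for total mass 1, obtained by integrating the pointwise
  inequality \<open>u \<le> (t + u\<^sup>2 / t) / 2\<close>.\<close>

lemma integral_cmod_le_of_square:
  assumes "square_integrable h" "integral\<^sup>L haar_torus (\<lambda>z. (cmod (h z))\<^sup>2) \<le> t\<^sup>2" "t > 0"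
  shows "integral\<^sup>L haar_torus (\<lambda>z. cmod (h z)) \<le> t"
proof -
  have *: "u \<le> (t + u\<^sup>2 / t) / 2" for u :: real
    using sum_squares_bound[of u t] \<open>t > 0\<close> by (simp add: field_simps power2_eq_square)
  have i: "integrable haar_torus (\<lambda>z. (cmod (h z))\<^sup>2)"
    using assms(1) by (simp add: square_integrable_def)
  have "integral\<^sup>L haar_torus (\<lambda>z. cmod (h z)) \<le> integral\<^sup>L haar_torus (\<lambda>z. (t + (cmod (h z))\<^sup>2 / t) / 2)"
    using * i square_integrable_integrable[OF assms(1)] by (intro integral_mono) auto
  also have "\<dots> = (t + integral\<^sup>L haar_torus (\<lambda>z. (cmod (h z))\<^sup>2) / t) / 2"
    using i by (simp add: haar_prob)
  also have "\<dots> \<le> t"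
    using assms(2,3) by (simp add: field_simps power2_eq_square)
  finally show ?thesis .
qed

text \<open>Finite sets carrying all but \<open>\<epsilon> n\<close> of the total are chosen
  independently, then accumulated into increasing unions. This selects fast partial sums without
  enumerating the lattice.\<close>

lemma summable_on_exhaustion:
  fixes a :: "'a \<Rightarrow> real" and \<epsilon> :: "nat \<Rightarrow> real"
  assumes "a summable_on UNIV" and nonneg: "\<And>x. a x \<ge> 0" and "\<And>n. \<epsilon> n > 0"
  obtains A where "\<And>n. finite (A n)" "\<And>n. A n \<subseteq> A (Suc n)"
    "\<And>n G. finite G \<Longrightarrow> G \<inter> A n = {} \<Longrightarrow> sum a G \<le> \<epsilon> n"
proof -
  have "\<exists>F. finite F \<and> infsum a UNIV - \<epsilon> n \<le> sum a F" for n
  proof -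
    have "\<forall>\<^sub>F F in finite_subsets_at_top UNIV. dist (sum a F) (infsum a UNIV) < \<epsilon> n"
      using has_sum_infsum[OF assms(1)] assms(3) unfolding has_sum_def by (rule tendstoD)
    then obtain F where "finite F" "dist (sum a F) (infsum a UNIV) < \<epsilon> n"
      unfolding eventually_finite_subsets_at_top by blast
    then show ?thesis by (auto simp: dist_real_def)
  qed
  then obtain F where F: "\<And>n. finite (F n)" "\<And>n. infsum a UNIV - \<epsilon> n \<le> sum a (F n)"
    by metis
  show thesis
  proof (rule that[of "\<lambda>n. \<Union>k\<le>n. F k"])
    fix n G assume G: "finite G" "G \<inter> (\<Union>k\<le>n. F k) = {}"
    then have "sum a G + sum a (F n) = sum a (G \<union> F n)"
      by (subst sum.union_disjoint) (auto simp: F)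
    also have "\<dots> \<le> infsum a UNIV"
      using G F by (intro finite_sum_le_infsum assms(1)) (auto simp: nonneg)
    finally show "sum a G \<le> \<epsilon> n" using F(2)[of n] by linarith
  qed (auto simp: F atMost_Suc)
qed

lemma riesz_fischer:
  fixes f :: "int^'d::finite \<Rightarrow> complex"
  assumes "l2s f"
  obtains h where "square_integrable h" "fcoef h = f"
    "integral\<^sup>L haar_torus (\<lambda>z. (cmod (h z))\<^sup>2) \<le> (\<Sum>\<^sub>\<infinity>x. (cmod (f x))\<^sup>2)"
proof -
  let ?a = "\<lambda>x. (cmod (f x))\<^sup>2"
  have summ: "?a summable_on UNIV" using assms by (simp add: l2s_def)
  \<comment> \<open>The tolerance is the square of \<open>(1/2)^n\<close>, so the increments
    \<open>d n\<close> have L^2 norm, and hence L^1 norm, at most \<open>(1/2)^n\<close>.\<close>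
  have "((1/2)^n)\<^sup>2 > (0::real)" for n by simp
  then obtain A where A: "\<And>n. finite (A n)" "\<And>n. A n \<subseteq> A (Suc n)"
    "\<And>n G. finite G \<Longrightarrow> G \<inter> A n = {} \<Longrightarrow> sum ?a G \<le> ((1/2)^n)\<^sup>2"
    using summable_on_exhaustion[OF summ, of "\<lambda>n. ((1/2)^n)\<^sup>2"] by auto
  define s where "s n = trig (A n) f" for n
  define d where "d n = trig (A (Suc n) - A n) f" for n
  have s: "square_integrable (s n)" and d: "square_integrable (d n)" for n
    by (simp_all add: s_def d_def square_integrable_trig)
  note [measurable] = square_integrable_measurable[OF s] square_integrable_measurable[OF d]
  have sd: "s (Suc n) z = s n z + d n z" for n z
    unfolding s_def d_def trig_def using sum.subset_diff[OF A(2)[of n] A(1)[of "Suc n"], of "\<lambda>x. f x * torus_pow z x"]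
    by simp
  have s_sum: "s n z = s 0 z + (\<Sum>k<n. d k z)" for n z
    by (induction n) (auto simp: sd)
  have "integral\<^sup>L haar_torus (\<lambda>z. (cmod (d n z))\<^sup>2) \<le> ((1/2)^n)\<^sup>2" for n
    unfolding d_def using A(3)[of "A (Suc n) - A n" n] A(1)[of "Suc n"]
    by (subst integral_norm_trig) auto
  then have dn: "integral\<^sup>L haar_torus (\<lambda>z. cmod (d n z)) \<le> (1/2)^n" for n
    by (intro integral_cmod_le_of_square d) auto
  have sums: "summable (\<lambda>n. integral\<^sup>L haar_torus (\<lambda>z. cmod (d n z)))"
    by (rule summable_comparison_test'[of "\<lambda>n. (1/2)^n" 0]) (auto simp: dn)
  \<comment> \<open>The integrals of \<open>cmod (d n z)\<close> have a finite sum, so by exchanging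
    sum and integral the sum of the moduli is finite almost everywhere.\<close>
  have AE_summ: "AE z in haar_torus. summable (\<lambda>n. cmod (d n z))"
  proof -
    have "(\<integral>\<^sup>+z. (\<Sum>n. ennreal (cmod (d n z))) \<partial>haar_torus) = (\<Sum>n. \<integral>\<^sup>+z. ennreal (cmod (d n z)) \<partial>haar_torus)"
      by (rule nn_integral_suminf) measurable
    also have "\<dots> = (\<Sum>n. ennreal (integral\<^sup>L haar_torus (\<lambda>z. cmod (d n z))))"
      using square_integrable_integrable[OF d]
      by (intro suminf_cong nn_integral_eq_integral) auto
    also have "\<dots> = ennreal (\<Sum>n. integral\<^sup>L haar_torus (\<lambda>z. cmod (d n z)))"
      by (rule suminf_ennreal2[OF _ sums]) (rule Bochner_Integration.integral_nonneg, simp)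
    also have "\<dots> \<noteq> \<infinity>"
      unfolding infinity_ennreal_def by (rule ennreal_neq_top)
    finally have "AE z in haar_torus. (\<Sum>n. ennreal (cmod (d n z))) \<noteq> \<infinity>"
      by (intro nn_integral_PInf_AE) auto
    then show ?thesis
      by eventually_elim (auto intro!: summable_suminf_not_top)
  qed
  \<comment> \<open>\<open>h\<close> is the almost everywhere limit of the partial sums, and
    \<open>G\<close> is an integrable majorant for all of them at once.\<close>
  define h where "h z = s 0 z + (\<Sum>n. d n z)" for z
  define G where "G z = cmod (s 0 z) + (\<Sum>n. cmod (d n z))" for z
  have int_h: "integrable haar_torus h"
    unfolding h_def using AE_summ sums
    by (intro Bochner_Integration.integrable_add square_integrable_integrable s integrable_suminf d) auto
  have int_G: "integrable haar_torus G"
    unfolding G_def using AE_summ sums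
    by (intro Bochner_Integration.integrable_add integrable_norm square_integrable_integrable s integrable_suminf d) auto
  note [measurable] = borel_measurable_integrable[OF int_h] borel_measurable_integrable[OF int_G]
  have lim: "AE z in haar_torus. (\<lambda>n. s n z) \<longlonglongrightarrow> h z"
    using AE_summ
  proof eventually_elim
    case (elim z)
    have "(\<lambda>n. s n z) = (\<lambda>n. s 0 z + (\<Sum>k<n. d k z))"
      by (rule ext) (rule s_sum)
    then show ?case
      unfolding h_def
      using tendsto_add[OF tendsto_const summable_LIMSEQ[OF summable_norm_cancel[OF elim]]] by simp
  qed
  have sG: "AE z in haar_torus. \<forall>n. cmod (s n z) \<le> G z"
    using AE_summ
  proof eventually_elim
    case (elim z)
    show ?case
    proof
      fix n
      have "cmod (s n z) \<le> cmod (s 0 z) + (\<Sum>k<n. cmod (d k z))"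
        unfolding s_sum[of n] by (intro norm_triangle_le add_left_mono norm_sum)
      also have "\<dots> \<le> G z"
        unfolding G_def using elim by (intro add_left_mono sum_le_suminf) auto
      finally show "cmod (s n z) \<le> G z" .
    qed
  qed
  have "fcoef h x = f x" for x
  proof (rule LIMSEQ_unique)
    show "(\<lambda>n. fcoef (s n) x) \<longlonglongrightarrow> fcoef h x"
      unfolding fcoef_def
    proof (rule integral_dominated_convergence[OF _ _ int_G])
      show "AE z in haar_torus. (\<lambda>n. torus_pow z (- x) * s n z) \<longlonglongrightarrow> torus_pow z (- x) * h z"
        using lim by eventually_elim (intro tendsto_intros)
      show "AE z in haar_torus. norm (torus_pow z (- x) * s n z) \<le> G z" for n
        using sG AE_haar_torus by eventually_elim (simp add: norm_mult norm_torus_pow)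
    qed measurable
    show "(\<lambda>n. fcoef (s n) x) \<longlonglongrightarrow> f x"
    proof (rule Lim_null_comparison[THEN LIM_zero_cancel])
      \<comment> \<open>If \<open>x\<close> lies in \<open>A n\<close>, the coefficient is already
        exact; otherwise \<open>{x}\<close> is disjoint from \<open>A n\<close> and the tail bound
        controls \<open>f x\<close>.\<close>
      have "cmod (fcoef (s n) x - f x) \<le> (1/2)^n" for n
        using A(3)[of "{x}" n] power2_le_imp_le[of "cmod (f x)" "(1/2)^n"]
        by (auto simp: s_def fcoef_trig A(1))
      then show "\<forall>\<^sub>F n in sequentially. norm (fcoef (s n) x - f x) \<le> (1/2)^n" by simp
      show "(\<lambda>n. (1/2)^n :: real) \<longlonglongrightarrow> 0" by (rule LIMSEQ_power_zero) auto
    qed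
  qed
  then have fc: "fcoef h = f" by auto
  let ?S = "\<Sum>\<^sub>\<infinity>x. (cmod (f x))\<^sup>2"
  \<comment> \<open>Fatou's lemma: the squared norms of the partial sums are finite sums of squared
    coefficients, each at most \<open>?S\<close>.\<close>
  have "(\<integral>\<^sup>+z. ennreal ((cmod (h z))\<^sup>2) \<partial>haar_torus) = (\<integral>\<^sup>+z. liminf (\<lambda>n. ennreal ((cmod (s n z))\<^sup>2)) \<partial>haar_torus)"
  proof (rule nn_integral_cong_AE)
    show "AE z in haar_torus. ennreal ((cmod (h z))\<^sup>2) = liminf (\<lambda>n. ennreal ((cmod (s n z))\<^sup>2))"
      using lim
    proof eventually_elim
      case (elim z)
      then have "(\<lambda>n. ennreal ((cmod (s n z))\<^sup>2)) \<longlonglongrightarrow> ennreal ((cmod (h z))\<^sup>2)"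
        by (intro tendsto_intros)
      then show ?case
        by (intro lim_imp_Liminf[symmetric]) auto
    qed
  qed
  also have "\<dots> \<le> liminf (\<lambda>n. \<integral>\<^sup>+z. ennreal ((cmod (s n z))\<^sup>2) \<partial>haar_torus)"
    by (rule nn_integral_liminf) measurable
  also have "\<dots> \<le> ennreal ?S"
  proof (rule Liminf_le[OF sequentially_bot always_eventually], rule allI)
    fix n
    have "(\<integral>\<^sup>+z. ennreal ((cmod (s n z))\<^sup>2) \<partial>haar_torus) = ennreal (integral\<^sup>L haar_torus (\<lambda>z. (cmod (s n z))\<^sup>2))"
      using s[of n] by (intro nn_integral_eq_integral) (auto simp: square_integrable_def)
    also have "integral\<^sup>L haar_torus (\<lambda>z. (cmod (s n z))\<^sup>2) = sum ?a (A n)"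
      unfolding s_def by (rule integral_norm_trig[OF A(1)])
    also have "ennreal \<dots> \<le> ennreal ?S"
      by (intro ennreal_leI finite_sum_le_infsum summ A(1)) auto
    finally show "(\<integral>\<^sup>+z. ennreal ((cmod (s n z))\<^sup>2) \<partial>haar_torus) \<le> ennreal ?S" .
  qed
  finally have le: "(\<integral>\<^sup>+z. ennreal ((cmod (h z))\<^sup>2) \<partial>haar_torus) \<le> ennreal ?S" .
  have ih: "integrable haar_torus (\<lambda>z. (cmod (h z))\<^sup>2)"
    using le by (intro integrableI_bounded) (auto simp: top.not_eq_extremum[symmetric] top_unique)
  have "ennreal (integral\<^sup>L haar_torus (\<lambda>z. (cmod (h z))\<^sup>2)) \<le> ennreal ?S"
    using le nn_integral_eq_integral[OF ih] by simp
  then have "integral\<^sup>L haar_torus (\<lambda>z. (cmod (h z))\<^sup>2) \<le> ?S"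
    by (subst (asm) ennreal_le_iff) (auto intro: infsum_nonneg)
  with ih fc show thesis
    by (intro that[of h]) (auto simp: square_integrable_def)
qed

text \<open>Bessel gives one inequality. For the other, Riesz--Fischer produces from the
  coefficients of \<open>h\<close> a function \<open>k\<close> whose norm is bounded by them, and
  uniqueness identifies \<open>k\<close> with \<open>h\<close> almost everywhere.\<close>

lemma plancherel:
  assumes h: "square_integrable h"
  shows "((\<lambda>x. (cmod (fcoef h x))\<^sup>2) has_sum integral\<^sup>L haar_torus (\<lambda>z. (cmod (h z))\<^sup>2)) UNIV"
proof -
  obtain k where k: "square_integrable k" "fcoef k = fcoef h"
    "integral\<^sup>L haar_torus (\<lambda>z. (cmod (k z))\<^sup>2) \<le> (\<Sum>\<^sub>\<infinity>x. (cmod (fcoef h x))\<^sup>2)"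
    using riesz_fischer[OF l2s_fcoef[OF h]] by blast
  have "AE z in haar_torus. h z = k z"
    using h k by (intro fcoef_eq_imp_AE_eq square_integrable_integrable) auto
  then have "AE z in haar_torus. (cmod (h z))\<^sup>2 = (cmod (k z))\<^sup>2"
    by eventually_elim simp
  then have "integral\<^sup>L haar_torus (\<lambda>z. (cmod (h z))\<^sup>2) = integral\<^sup>L haar_torus (\<lambda>z. (cmod (k z))\<^sup>2)"
    using h k(1) by (intro integral_cong_AE) (auto simp: square_integrable_def)
  then have "(\<Sum>\<^sub>\<infinity>x. (cmod (fcoef h x))\<^sup>2) = integral\<^sup>L haar_torus (\<lambda>z. (cmod (h z))\<^sup>2)"
    using infsum_fcoef_le[OF h] k(3) by linarith
  then show ?thesis
    using l2s_fcoef[OF h] by (metis has_sum_infsum l2s_def)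
qed

lemma complex_polarization:
  fixes a b :: complex
  defines "T c \<equiv> c * of_real ((cmod (a + c * b))\<^sup>2)"
  shows "4 * (a * cnj b) = T 1 + T (- 1) + T \<i> + T (- \<i>)"
  unfolding T_def complex_norm_square by (simp add: algebra_simps)

text \<open>Polarization of Plancherel: the same identity over the four values 1, -1, \<i>, -\<i> of
  \<open>c\<close> is applied to the integrand and to the coefficients, since taking coefficients is
  linear.\<close>

lemma parseval:
  assumes h: "square_integrable h" and k: "square_integrable k"
  shows "((\<lambda>x. fcoef h x * cnj (fcoef k x)) has_sum integral\<^sup>L haar_torus (\<lambda>z. h z * cnj (k z))) UNIV"
proof -
  define T where "T c z = c * complex_of_real ((cmod (h z + c * k z))\<^sup>2)" for c z
  have sq: "square_integrable (\<lambda>z. h z + c * k z)" for c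
    by (intro square_integrable_add square_integrable_cmult h k)
  have int: "integrable haar_torus (T c)" for c
    using sq[of c] unfolding T_def
    by (intro integrable_mult_right integrable_of_real) (simp add: square_integrable_def)
  have fc: "fcoef (\<lambda>z. h z + c * k z) x = fcoef h x + c * fcoef k x" for c x
    using h k by (simp add: fcoef_add fcoef_cmult square_integrable_integrable)
  have T: "((\<lambda>x. c * complex_of_real ((cmod (fcoef h x + c * fcoef k x))\<^sup>2)) has_sum integral\<^sup>L haar_torus (T c)) UNIV" for c
  proof -
    have "integral\<^sup>L haar_torus (T c) = c * complex_of_real (integral\<^sup>L haar_torus (\<lambda>z. (cmod (h z + c * k z))\<^sup>2))"
      unfolding T_def by (simp only: integral_mult_right_zero integral_complex_of_real)
    then show ?thesis
      using plancherel[OF sq, of c] unfolding fc by (simp only: has_sum_cmult_right has_sum_of_real)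
  qed
  have "integral\<^sup>L haar_torus (\<lambda>z. 4 * (h z * cnj (k z))) = integral\<^sup>L haar_torus (\<lambda>z. T 1 z + T (- 1) z + T \<i> z + T (- \<i>) z)"
    unfolding T_def complex_polarization ..
  also have "\<dots> = integral\<^sup>L haar_torus (T 1) + integral\<^sup>L haar_torus (T (- 1)) + integral\<^sup>L haar_torus (T \<i>) + integral\<^sup>L haar_torus (T (- \<i>))"
    using int by simp
  finally have "((\<lambda>x. 4 * (fcoef h x * cnj (fcoef k x))) has_sum integral\<^sup>L haar_torus (\<lambda>z. 4 * (h z * cnj (k z)))) UNIV"
    unfolding complex_polarization by (simp only: has_sum_add T)
  from has_sum_cmult_right[OF this, of "1/4"] show ?thesis by simp
qed

lemma has_sum_fcoef_mult:
  assumes h: "square_integrable h" and k: "square_integrable k"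
  shows "((\<lambda>y. fcoef h (x - y) * fcoef k y) has_sum fcoef (\<lambda>z. h z * k z) x) UNIV"
proof -
  note [measurable] = square_integrable_measurable[OF h] square_integrable_measurable[OF k]
  \<comment> \<open>Chosen so that the coefficient of \<open>K\<close> at \<open>y\<close> is the
    conjugate of \<open>fcoef h (x - y)\<close>; Parseval for \<open>k\<close> and \<open>K\<close>
    then is the convolution formula.\<close>
  define K where "K z = torus_pow z x * cnj (h z)" for z
  have [measurable]: "K \<in> borel_measurable haar_torus" unfolding K_def by measurable
  have K: "square_integrable K"
  proof -
    have "AE z in haar_torus. cmod (torus_pow z x) \<le> 1"
      using AE_haar_torus by eventually_elim (simp add: norm_torus_pow)
    then show ?thesis
      using square_integrable_mult_bounded[OF square_integrable_cnj[OF h] measurable_torus_pow]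
      unfolding K_def mult.commute[of "torus_pow _ _"] by blast
  qed
  have "cnj (fcoef K y) = fcoef h (x - y)" for y
    unfolding K_def by (simp add: fcoef_torus_pow_mult fcoef_cnj)
  moreover have "integral\<^sup>L haar_torus (\<lambda>z. k z * cnj (K z)) = fcoef (\<lambda>z. h z * k z) x"
    unfolding fcoef_def
  proof (rule integral_cong_AE)
    show "AE z in haar_torus. k z * cnj (K z) = torus_pow z (- x) * (h z * k z)"
      using AE_haar_torus by eventually_elim (simp add: K_def cnj_torus_pow)
  qed measurable
  ultimately show ?thesis
    using parseval[OF k K] by (simp add: mult.commute)
qed

section \<open>The symbol of the walk\<close>

lemma cinner_add_left: "cinner (x + y) u = cinner x u + cinner y u"
  by (simp add: cinner_def distrib_right sum.distrib)

lemma cinner_scale_left: "cinner (c *s x) y = c * cinner x y"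
  by (simp add: cinner_def sum_distrib_left mult.assoc)

lemma cinner_sum_left: "cinner (\<Sum>i\<in>I. f i) y = (\<Sum>i\<in>I. cinner (f i) y)"
  by (induction I rule: infinite_finite_induct) (auto simp: cinner_add_left, auto simp: cinner_def)

lemma norm_vec_power2: "(norm x)\<^sup>2 = (\<Sum>i\<in>UNIV. (norm (x $ i))\<^sup>2)"
  by (simp add: norm_vec_def L2_set_def sum_nonneg)

lemma cinner_self: "cinner x x = of_real ((norm x)\<^sup>2)"
  unfolding norm_vec_power2 cinner_def by (simp add: of_real_cmod_square)

lemma cinner_matrix_left: "cinner (A *v x) y = cinner x (cadj A *v y)"
proof -
  have "cinner (A *v x) y = (\<Sum>i\<in>UNIV. \<Sum>j\<in>UNIV. A $ i $ j * x $ j * cnj (y $ i))"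
    by (simp add: cinner_def matrix_vector_mult_def sum_distrib_right)
  also have "\<dots> = (\<Sum>j\<in>UNIV. \<Sum>i\<in>UNIV. A $ i $ j * x $ j * cnj (y $ i))"
    by (rule sum.swap)
  also have "\<dots> = cinner x (cadj A *v y)"
    by (simp add: cinner_def matrix_vector_mult_def sum_distrib_left cadj_def mult_ac)
  finally show ?thesis .
qed

lemma cinner_orth_proj: 
  assumes "orth_proj P"
  shows "cinner (P *v x) x = of_real ((norm (P *v x))\<^sup>2)"
proof -
  have "cinner (P *v x) x = cinner (P *v (P *v x)) x"
    using assms by (simp add: orth_proj_def matrix_vector_mul_assoc)
  also have "\<dots> = cinner (P *v x) (P *v x)"
    using assms by (simp add: cinner_matrix_left[of P "P *v x"] orth_proj_def)
  finally show ?thesis by (simp add: cinner_self)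
qed

lemma sum_matrix_vector_mult: "(\<Sum>i\<in>I. A i) *v x = (\<Sum>i\<in>I. A i *v x)"
  by (induction I rule: infinite_finite_induct) (auto simp: matrix_vector_mult_add_rdistrib)

lemma matrix_vector_mult_sum: "A *v (\<Sum>i\<in>I. f i) = (\<Sum>i\<in>I. A *v f i)"
  by (induction I rule: infinite_finite_induct) (auto simp: matrix_vector_right_distrib)

lemma cmat_scale_vector_mult: "cmat_scale c A *v x = c *s (A *v x)"
  by (simp add: vec_eq_iff cmat_scale_def matrix_vector_mult_def sum_distrib_left mult.assoc)

lemma coin_scale: "coin \<mu> (c *s x) = c *s coin \<mu> x"
  by (simp add: vec_eq_iff coin_def cinner_scale_left algebra_simps)

text \<open>The reflection \<open>2 \<mu> \<mu>^* - I\<close> as a matrix, so that the walk can be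
  expanded in scalar components.\<close>

definition coin_matrix :: "complex^'n \<Rightarrow> complex^'n^'n" where
  "coin_matrix \<mu> = (\<chi> i j. 2 * \<mu> $ i * cnj (\<mu> $ j) - (if i = j then 1 else 0))"

lemma coin_eq_matrix: "coin \<mu> x = coin_matrix \<mu> *v x"
proof -
  have "(coin_matrix \<mu> *v x) $ i = (\<Sum>j\<in>UNIV. 2 * \<mu> $ i * (x $ j * cnj (\<mu> $ j))) - (\<Sum>j\<in>UNIV. if i = j then x $ j else 0)" for i
    unfolding sum_subtractf[symmetric]
    by (auto simp: coin_matrix_def matrix_vector_mult_def algebra_simps intro!: sum.cong)
  then show ?thesis
    by (simp add: vec_eq_iff coin_def cinner_def sum_distrib_left mult_ac)
qed

lemma borel_measurable_vec:
  fixes f :: "'a \<Rightarrow> complex^'n"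
  assumes "\<And>i. (\<lambda>z. f z $ i) \<in> borel_measurable M"
  shows "f \<in> borel_measurable M"
  unfolding borel_measurable_euclidean_space[of f]
  using assms by (auto simp: Basis_vec_def inner_axis intro!: borel_measurable_inner)

lemma borel_measurable_vec_nth:
  fixes f :: "'a \<Rightarrow> complex^'n"
  assumes "f \<in> borel_measurable M"
  shows "(\<lambda>z. f z $ i) \<in> borel_measurable M"
  by (rule measurable_compose[OF assms borel_measurable_continuous_onI]) (intro continuous_intros)

lemma has_sum_vec:
  fixes f :: "'a \<Rightarrow> complex^'n"
  assumes "\<And>i. ((\<lambda>x. f x $ i) has_sum (l $ i)) A"
  shows "(f has_sum l) A"
  using assms unfolding has_sum_def by (intro vec_tendstoI) simp

lemma finite_sum_summable_on:
  fixes f :: "'i \<Rightarrow> 'a \<Rightarrow> 'b::{topological_comm_monoid_add, t2_space}"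
  assumes "\<And>i. i \<in> I \<Longrightarrow> f i summable_on A"
  shows "(\<lambda>x. \<Sum>i\<in>I. f i x) summable_on A"
  using assms by (induction I rule: infinite_finite_induct) (auto intro: summable_on_add)

lemma l2v_iff_l2s: "l2v f \<longleftrightarrow> (\<forall>i. l2s (\<lambda>x. f x $ i))"
proof
  assume "l2v f"
  show "\<forall>i. l2s (\<lambda>x. f x $ i)"
    unfolding l2s_def
  proof
    fix i
    show "(\<lambda>x. (cmod (f x $ i))\<^sup>2) summable_on UNIV"
      by (rule summable_on_comparison_test[OF \<open>l2v f\<close>[unfolded l2v_def]])
         (auto intro!: power_mono Finite_Cartesian_Product.norm_nth_le)
  qed
next
  assume "\<forall>i. l2s (\<lambda>x. f x $ i)"
  then show "l2v f"
    unfolding l2v_def l2s_def norm_vec_power2 by (intro finite_sum_summable_on) auto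
qed

section \<open>Fixed vectors of the symbol at regular frequencies\<close>

locale coined_walk =
  fixes S :: "(int^'d::finite) set"
    and P :: "int^'d \<Rightarrow> complex^'n::finite^'n"
    and \<mu> :: "complex^'n"
  assumes finite_S: "finite S"
    and sym_S: "\<And>\<alpha>. \<alpha> \<in> S \<Longrightarrow> - \<alpha> \<in> S"
    and res: "resolution_of_unity S P"
    and norm_mu: "norm \<mu> = 1"
    and norm_sym: "\<And>\<alpha>. \<alpha> \<in> S \<Longrightarrow> norm (P \<alpha> *v \<mu>) = norm (P (- \<alpha>) *v \<mu>)"
begin

lemma proj_sum: "(\<Sum>\<alpha>\<in>S. P \<alpha> *v x) = x"
  using res by (simp add: resolution_of_unity_def flip: sum_matrix_vector_mult)

lemma proj_proj: "\<alpha> \<in> S \<Longrightarrow> \<beta> \<in> S \<Longrightarrow> P \<alpha> *v (P \<beta> *v x) = (if \<alpha> = \<beta> then P \<alpha> *v x else 0)"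
  using res by (auto simp: resolution_of_unity_def orth_proj_def matrix_vector_mul_assoc)

lemma proj_orth_sum:
  assumes "\<beta> \<in> S"
  shows "P \<beta> *v (\<Sum>\<alpha>\<in>S. c \<alpha> *s (P \<alpha> *v x \<alpha>)) = c \<beta> *s (P \<beta> *v x \<beta>)"
proof -
  have "P \<beta> *v (\<Sum>\<alpha>\<in>S. c \<alpha> *s (P \<alpha> *v x \<alpha>)) = (\<Sum>\<alpha>\<in>S. if \<alpha> = \<beta> then c \<alpha> *s (P \<alpha> *v x \<alpha>) else 0)"
    using assms by (auto simp: matrix_vector_mult_sum vector_scalar_commute[symmetric] proj_proj intro!: sum.cong)
  then show ?thesis using assms finite_S by simp
qed

text \<open>The unnormalised \<open>w_o\<close>: since
  \<open>1 - (1 - t) / (1 + t) = 2 * t / (1 + t)\<close>, this is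
  \<open>\<mu> - eta S P z *v \<mu>\<close> off \<open>torus_E S\<close>.\<close>

definition direction :: "('d \<Rightarrow> complex) \<Rightarrow> complex^'n" where
  "direction z = (\<Sum>\<alpha>\<in>S. (2 * torus_pow z \<alpha> / (1 + torus_pow z \<alpha>)) *s (P \<alpha> *v \<mu>))"

text \<open>The action of the walk at the single frequency \<open>z\<close>.\<close>

definition walk_symbol :: "('d \<Rightarrow> complex) \<Rightarrow> complex^'n \<Rightarrow> complex^'n" where
  "walk_symbol z \<phi> = (\<Sum>\<alpha>\<in>S. torus_pow z \<alpha> *s (P \<alpha> *v coin \<mu> \<phi>))"

lemma AE_regular: "AE z in haar_torus. z \<in> torus - torus_E S"
proof -
  have "AE z in haar_torus. \<forall>\<alpha>\<in>S. torus_pow z \<alpha> \<noteq> - 1"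
    using finite_S by (intro AE_finite_allI AE_torus_pow_neq_minus_1)
  then show ?thesis
    using AE_haar_torus by eventually_elim (auto simp: torus_E_def)
qed

context
  fixes z :: "'d \<Rightarrow> complex"
  assumes z: "z \<in> torus - torus_E S"
begin

lemma one_plus_torus_pow: "\<alpha> \<in> S \<Longrightarrow> 1 + torus_pow z \<alpha> \<noteq> 0"
  using z by (auto simp: torus_E_def add_eq_0_iff)

text \<open>The pairing is a sum of \<open>2 * t / (1 + t)\<close> weighted by
  \<open>n \<alpha>\<close>. Replacing \<open>\<alpha>\<close> by \<open>- \<alpha>\<close> inverts
  \<open>t\<close> and, by the norm symmetry, keeps the weights, so the same number is the weighted
  sum of \<open>2 / (1 + t)\<close>. The two fractions add up to 2 and the weights to the squared
  norm of \<open>\<mu>\<close>, which is 1.\<close>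

lemma cinner_direction: "cinner (direction z) \<mu> = 1"
proof -
  define n where "n \<alpha> = complex_of_real ((norm (P \<alpha> *v \<mu>))\<^sup>2)" for \<alpha>
  let ?t = "torus_pow z"
  have n: "cinner (P \<alpha> *v \<mu>) \<mu> = n \<alpha>" if "\<alpha> \<in> S" for \<alpha>
    using that res cinner_orth_proj[of "P \<alpha>"] by (simp add: resolution_of_unity_def n_def)
  have "cinner \<mu> \<mu> = (\<Sum>\<alpha>\<in>S. n \<alpha>)"
    using arg_cong[OF proj_sum, of "\<lambda>x. cinner x \<mu>" \<mu>] by (simp add: cinner_sum_left n)
  then have sum_n: "(\<Sum>\<alpha>\<in>S. n \<alpha>) = 1"
    by (simp add: cinner_self norm_mu)
  have c: "cinner (direction z) \<mu> = (\<Sum>\<alpha>\<in>S. 2 * ?t \<alpha> / (1 + ?t \<alpha>) * n \<alpha>)"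
    by (simp add: direction_def cinner_sum_left cinner_scale_left n)
  also have "\<dots> = (\<Sum>\<alpha>\<in>S. 2 * ?t (- \<alpha>) / (1 + ?t (- \<alpha>)) * n (- \<alpha>))"
    by (rule sum.reindex_bij_witness[of _ uminus uminus]) (auto simp: sym_S)
  also have "\<dots> = (\<Sum>\<alpha>\<in>S. 2 / (1 + ?t \<alpha>) * n \<alpha>)"
  proof (rule sum.cong[OF refl])
    fix \<alpha> assume "\<alpha> \<in> S"
    then have "n (- \<alpha>) = n \<alpha>" by (simp add: n_def norm_sym[of \<alpha>])
    moreover have "2 * ?t (- \<alpha>) / (1 + ?t (- \<alpha>)) = 2 / (1 + ?t \<alpha>)"
      using one_plus_torus_pow[OF \<open>\<alpha> \<in> S\<close>] one_plus_torus_pow[OF sym_S[OF \<open>\<alpha> \<in> S\<close>]] torus_pow_nonzero[of z \<alpha>] z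
      by (simp add: torus_pow_minus field_simps)
    ultimately show "2 * ?t (- \<alpha>) / (1 + ?t (- \<alpha>)) * n (- \<alpha>) = 2 / (1 + ?t \<alpha>) * n \<alpha>"
      by simp
  qed
  finally have c': "cinner (direction z) \<mu> = (\<Sum>\<alpha>\<in>S. 2 / (1 + ?t \<alpha>) * n \<alpha>)" .
  have "2 * cinner (direction z) \<mu> = (\<Sum>\<alpha>\<in>S. 2 * ?t \<alpha> / (1 + ?t \<alpha>) * n \<alpha> + 2 / (1 + ?t \<alpha>) * n \<alpha>)"
    unfolding sum.distrib by (subst mult_2) (rule arg_cong2[OF c c'])
  also have "\<dots> = (\<Sum>\<alpha>\<in>S. 2 * n \<alpha>)"
    using one_plus_torus_pow by (intro sum.cong) (auto simp: divide_simps, auto simp: algebra_simps)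
  also have "\<dots> = 2" by (simp add: sum_n flip: sum_distrib_left)
  finally show ?thesis by simp
qed

lemma direction_neq_0: "direction z \<noteq> 0"
  using cinner_direction by (auto simp: cinner_def)

text \<open>As the pairing with \<open>\<mu>\<close> is 1, the coin sends \<open>direction z\<close>
  to \<open>2 \<mu> - direction z\<close>. On the range of \<open>P \<alpha>\<close> the factor
  becomes \<open>2 - 2 * t / (1 + t) = 2 / (1 + t)\<close>, and multiplication by \<open>t\<close>
  restores the original one.\<close>

lemma walk_symbol_direction: "walk_symbol z (direction z) = direction z"
proof -
  have "torus_pow z \<alpha> *s (P \<alpha> *v coin \<mu> (direction z)) = (2 * torus_pow z \<alpha> / (1 + torus_pow z \<alpha>)) *s (P \<alpha> *v \<mu>)" if "\<alpha> \<in> S" for \<alpha>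
  proof -
    have "P \<alpha> *v direction z = (2 * torus_pow z \<alpha> / (1 + torus_pow z \<alpha>)) *s (P \<alpha> *v \<mu>)"
      unfolding direction_def by (rule proj_orth_sum[OF that])
    then have "P \<alpha> *v coin \<mu> (direction z) = 2 *s (P \<alpha> *v \<mu>) - (2 * torus_pow z \<alpha> / (1 + torus_pow z \<alpha>)) *s (P \<alpha> *v \<mu>)"
      by (simp add: coin_def cinner_direction matrix_vector_mult_diff_distrib vector_scalar_commute)
    then show ?thesis
      using one_plus_torus_pow[OF that] by (simp add: vec_eq_iff field_simps)
  qed
  then show ?thesis
    by (simp add: walk_symbol_def direction_def)
qed

text \<open>Each projection isolates one summand of the fixed point equation; off
  \<open>torus_E S\<close> it can be solved for \<open>P \<beta> *v \<phi>\<close>, and the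
  resolution of unity reassembles \<open>\<phi>\<close>.\<close>

lemma walk_symbol_fixed_imp:
  assumes "walk_symbol z \<phi> = \<phi>"
  shows "\<phi> = cinner \<phi> \<mu> *s direction z"
proof -
  have "P \<beta> *v \<phi> = cinner \<phi> \<mu> *s ((2 * torus_pow z \<beta> / (1 + torus_pow z \<beta>)) *s (P \<beta> *v \<mu>))" if "\<beta> \<in> S" for \<beta>
  proof -
    have "P \<beta> *v \<phi> = P \<beta> *v walk_symbol z \<phi>" by (simp add: assms)
    also have "\<dots> = torus_pow z \<beta> *s (P \<beta> *v coin \<mu> \<phi>)"
      unfolding walk_symbol_def by (rule proj_orth_sum[OF that])
    also have "\<dots> = torus_pow z \<beta> *s ((2 * cinner \<phi> \<mu>) *s (P \<beta> *v \<mu>) - P \<beta> *v \<phi>)"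
      by (simp add: coin_def matrix_vector_mult_diff_distrib vector_scalar_commute)
    finally have eq: "P \<beta> *v \<phi> = torus_pow z \<beta> *s ((2 * cinner \<phi> \<mu>) *s (P \<beta> *v \<mu>) - P \<beta> *v \<phi>)" .
    have *: "(P \<beta> *v \<phi>) $ i = torus_pow z \<beta> * (2 * cinner \<phi> \<mu> * (P \<beta> *v \<mu>) $ i - (P \<beta> *v \<phi>) $ i)" for i
      by (subst eq) (simp add: right_diff_distrib mult.assoc)
    have "(1 + torus_pow z \<beta>) * (P \<beta> *v \<phi>) $ i = 2 * torus_pow z \<beta> * cinner \<phi> \<mu> * (P \<beta> *v \<mu>) $ i" for i
      using *[of i] by (simp add: algebra_simps)
    then show ?thesis
      using one_plus_torus_pow[OF that] by (simp add: vec_eq_iff field_simps)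
  qed
  then have "(\<Sum>\<beta>\<in>S. P \<beta> *v \<phi>) = cinner \<phi> \<mu> *s direction z"
    by (simp add: direction_def vec.scale_sum_right)
  then show ?thesis by (simp add: proj_sum)
qed

end

lemma mu_minus_eta:
  assumes "z \<notin> torus_E S"
  shows "\<mu> - eta S P z *v \<mu> = direction z"
proof -
  have "\<mu> - eta S P z *v \<mu> = (\<Sum>\<alpha>\<in>S. P \<alpha> *v \<mu> - ((1 - torus_pow z \<alpha>) / (1 + torus_pow z \<alpha>)) *s (P \<alpha> *v \<mu>))"
    by (simp add: eta_def sum_matrix_vector_mult cmat_scale_vector_mult sum_subtractf proj_sum)
  also have "\<dots> = direction z"
    unfolding direction_def
  proof (rule sum.cong[OF refl])
    fix \<alpha> assume "\<alpha> \<in> S"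
    then have "1 + torus_pow z \<alpha> \<noteq> 0" using assms by (auto simp: torus_E_def add_eq_0_iff)
    then show "P \<alpha> *v \<mu> - ((1 - torus_pow z \<alpha>) / (1 + torus_pow z \<alpha>)) *s (P \<alpha> *v \<mu>)
        = (2 * torus_pow z \<alpha> / (1 + torus_pow z \<alpha>)) *s (P \<alpha> *v \<mu>)"
      by (simp add: vec_eq_iff field_simps)
  qed
  finally show ?thesis .
qed

text \<open>A form suited to measurability: the exceptional set appears as a finite disjunction, and
  the real scaling as a complex one.\<close>

lemma w_o_eq:
  "w_o S P \<mu> z = (if \<exists>\<alpha>\<in>S. torus_pow z \<alpha> = - 1 then 0 else of_real (inverse (norm (direction z))) *s direction z)"
proof -
  have scaleR: "r *\<^sub>R v = complex_of_real r *s v" for r and v :: "complex^'n"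
    unfolding vec_eq_iff vector_scaleR_component vector_smult_component by (simp add: scaleR_conv_of_real)
  show ?thesis
    using mu_minus_eta[of z] by (auto simp: w_o_def torus_E_def Let_def scaleR)
qed

lemma w_o_regular: "z \<notin> torus_E S \<Longrightarrow> w_o S P \<mu> z = of_real (inverse (norm (direction z))) *s direction z"
  by (auto simp: w_o_eq torus_E_def)

lemma norm_w_o: "z \<in> torus - torus_E S \<Longrightarrow> norm (w_o S P \<mu> z) = 1"
  using direction_neq_0[of z] mu_minus_eta[of z] by (simp add: w_o_def Let_def)

lemma walk_symbol_w_o: 
  assumes "z \<in> torus - torus_E S"
  shows "walk_symbol z (c *s w_o S P \<mu> z) = c *s w_o S P \<mu> z"
proof -
  have scale: "walk_symbol z (a *s x) = a *s walk_symbol z x" for a x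
    by (simp add: walk_symbol_def coin_scale vector_scalar_commute vec.scale_sum_right mult.commute)
  show ?thesis
    using assms by (simp add: w_o_regular scale walk_symbol_direction)
qed

text \<open>Because \<open>w_o\<close> has norm 1, the coefficient of a fixed vector is its inner
  product with \<open>w_o\<close>. This explicit formula later gives a measurable, square integrable
  coefficient function.\<close>

lemma walk_symbol_fixed_imp_w_o:
  assumes z: "z \<in> torus - torus_E S" and "walk_symbol z \<phi> = \<phi>"
  shows "\<phi> = cinner \<phi> (w_o S P \<mu> z) *s w_o S P \<mu> z"
proof -
  let ?w = "w_o S P \<mu> z"
  have "\<phi> = cinner \<phi> \<mu> *s direction z" by (rule walk_symbol_fixed_imp[OF assms])
  also have "direction z = of_real (norm (direction z)) *s ?w"
    using z direction_neq_0[OF z] by (simp add: w_o_regular)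
  finally obtain c where c: "\<phi> = c *s ?w" by (metis vec.scale_scale)
  then have "cinner \<phi> ?w = c"
    using norm_w_o[OF z] by (simp add: cinner_scale_left cinner_self)
  then show ?thesis using c by simp
qed

section \<open>Convolution with \<open>w\<close> as multiplication by \<open>w_o\<close>\<close>

lemma w_o_measurable: "w_o S P \<mu> \<in> borel_measurable haar_torus"
proof (rule borel_measurable_vec)
  fix i
  have d: "(\<lambda>z. direction z $ j) \<in> borel_measurable haar_torus" for j
    unfolding direction_def by simp
  have [measurable]: "direction \<in> borel_measurable haar_torus"
    by (rule borel_measurable_vec[OF d])
  note [measurable] = d
  have [measurable]: "Measurable.pred haar_torus (\<lambda>z. \<exists>\<alpha>\<in>S. torus_pow z \<alpha> = - 1)"
    using finite_S by measurable
  have "(\<lambda>z. w_o S P \<mu> z $ i)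
      = (\<lambda>z. if \<exists>\<alpha>\<in>S. torus_pow z \<alpha> = - 1 then 0 else of_real (inverse (norm (direction z))) * direction z $ i)"
    by (auto simp: w_o_eq)
  also have "\<dots> \<in> borel_measurable haar_torus"
    by measurable
  finally show "(\<lambda>z. w_o S P \<mu> z $ i) \<in> borel_measurable haar_torus" .
qed

lemma w_o_nth_measurable: "(\<lambda>z. w_o S P \<mu> z $ i) \<in> borel_measurable haar_torus"
  by (rule borel_measurable_vec_nth[OF w_o_measurable])

lemma w_o_nth_bounded: "AE z in haar_torus. cmod (w_o S P \<mu> z $ i) \<le> 1"
  using AE_regular
proof eventually_elim
  case (elim z)
  then show ?case using norm_w_o Finite_Cartesian_Product.norm_nth_le[of "w_o S P \<mu> z" i] by simp
qed

text \<open>Coordinate projections are bounded linear and so commute with the Bochner integral,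
  which exists as the integrand has norm 1 almost everywhere.\<close>

lemma inv_fourier_w_o_nth: "inv_fourier (w_o S P \<mu>) x $ i = fcoef (\<lambda>z. w_o S P \<mu> z $ i) x"
proof -
  note [measurable] = w_o_nth_measurable
  have "integrable haar_torus (\<lambda>z. torus_pow z (- x) *s w_o S P \<mu> z)"
  proof (rule haar.integrable_const_bound[where B = 1])
    show "AE z in haar_torus. norm (torus_pow z (- x) *s w_o S P \<mu> z) \<le> 1"
      using AE_regular
    proof eventually_elim
      case (elim z)
      have "(norm (torus_pow z (- x) *s w_o S P \<mu> z))\<^sup>2 = (norm (w_o S P \<mu> z))\<^sup>2"
        using elim by (simp add: norm_vec_power2 norm_mult norm_torus_pow)
      then have "norm (torus_pow z (- x) *s w_o S P \<mu> z) = norm (w_o S P \<mu> z)"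
        by (rule power2_eq_imp_eq) auto
      then show ?case using norm_w_o[OF elim] by simp
    qed
    show "(\<lambda>z. torus_pow z (- x) *s w_o S P \<mu> z) \<in> borel_measurable haar_torus"
      by (rule borel_measurable_vec) simp
  qed
  from integral_bounded_linear[OF bounded_linear_vec_nth this, of i] show ?thesis
    by (simp add: inv_fourier_def fcoef_def)
qed

lemma conv_inv_fourier_nth:
  assumes h: "square_integrable h"
  shows "conv (fcoef h) (inv_fourier (w_o S P \<mu>)) x $ i = fcoef (\<lambda>z. h z * w_o S P \<mu> z $ i) x"
proof -
  let ?w = "inv_fourier (w_o S P \<mu>)"
  have "((\<lambda>y. fcoef h (x - y) *s ?w y) has_sum (\<chi> i. fcoef (\<lambda>z. h z * w_o S P \<mu> z $ i) x)) UNIV"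
  proof (rule has_sum_vec)
    fix i
    have "square_integrable (\<lambda>z. w_o S P \<mu> z $ i)"
      by (rule square_integrable_bounded[OF w_o_nth_measurable w_o_nth_bounded])
    from has_sum_fcoef_mult[OF h this, of x]
    show "((\<lambda>y. (fcoef h (x - y) *s ?w y) $ i) has_sum (\<chi> i. fcoef (\<lambda>z. h z * w_o S P \<mu> z $ i) x) $ i) UNIV"
      by (simp add: inv_fourier_w_o_nth)
  qed
  then show ?thesis
    unfolding conv_def by (simp add: infsumI)
qed

section \<open>The walk on the Fourier side and the two inclusions\<close>

lemma walk_symbol_nth:
  "walk_symbol z \<phi> $ i = (\<Sum>\<alpha>\<in>S. torus_pow z \<alpha> * (\<Sum>j\<in>UNIV. (P \<alpha> ** coin_matrix \<mu>) $ i $ j * \<phi> $ j))"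
  by (simp add: walk_symbol_def coin_eq_matrix matrix_vector_mul_assoc)
     (simp add: matrix_vector_mult_def)

lemma walk_op_nth:
  "walk_op S P (coin \<mu>) f x $ i = (\<Sum>\<alpha>\<in>S. \<Sum>j\<in>UNIV. (P \<alpha> ** coin_matrix \<mu>) $ i $ j * f (x - \<alpha>) $ j)"
  by (simp add: walk_op_def shift_def coin_eq_matrix matrix_vector_mul_assoc)
     (simp add: matrix_vector_mult_def)

text \<open>Each component of the symbol is a finite sum of characters times linear combinations of
  the components of \<open>\<phi>\<close>. Characters have modulus 1 on the torus, which keeps
  square integrability, and they act on coefficients as the shifts in
  \<open>walk_op\<close>.\<close>

lemma
  assumes \<phi>: "\<And>j. square_integrable (\<lambda>z. \<phi> z $ j)"
  shows square_integrable_walk_symbol: "square_integrable (\<lambda>z. walk_symbol z (\<phi> z) $ i)"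
    and fcoef_walk_symbol: "(\<And>x j. f x $ j = fcoef (\<lambda>z. \<phi> z $ j) x) \<Longrightarrow>
      walk_op S P (coin \<mu>) f x $ i = fcoef (\<lambda>z. walk_symbol z (\<phi> z) $ i) x"
proof -
  define q where "q \<alpha> z = (\<Sum>j\<in>UNIV. (P \<alpha> ** coin_matrix \<mu>) $ i $ j * \<phi> z $ j)" for \<alpha> z
  have q: "square_integrable (q \<alpha>)" for \<alpha>
    unfolding q_def by (intro square_integrable_sum square_integrable_cmult \<phi>)
  have tq: "square_integrable (\<lambda>z. torus_pow z \<alpha> * q \<alpha> z)" for \<alpha>
  proof -
    have "AE z in haar_torus. cmod (torus_pow z \<alpha>) \<le> 1"
      using AE_haar_torus by eventually_elim (simp add: norm_torus_pow)
    then show ?thesis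
      using square_integrable_mult_bounded[OF q measurable_torus_pow] by (simp add: mult.commute)
  qed
  show "square_integrable (\<lambda>z. walk_symbol z (\<phi> z) $ i)"
    unfolding walk_symbol_nth q_def[symmetric] by (intro square_integrable_sum tq)
  assume f: "\<And>x j. f x $ j = fcoef (\<lambda>z. \<phi> z $ j) x"
  have fq: "fcoef (q \<alpha>) y = (\<Sum>j\<in>UNIV. (P \<alpha> ** coin_matrix \<mu>) $ i $ j * f y $ j)" for \<alpha> y
    unfolding q_def
    by (subst fcoef_sum) (auto simp: fcoef_cmult f intro!: square_integrable_integrable square_integrable_cmult \<phi>)
  show "walk_op S P (coin \<mu>) f x $ i = fcoef (\<lambda>z. walk_symbol z (\<phi> z) $ i) x"
    unfolding walk_symbol_nth q_def[symmetric] walk_op_nth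
    by (subst fcoef_sum)
       (auto simp: fcoef_torus_pow_mult square_integrable_measurable[OF q] fq intro!: square_integrable_integrable tq)
qed

lemma conv_in_eigenspace:
  assumes "l2s g"
  shows "l2v (conv g (inv_fourier (w_o S P \<mu>)))"
    and "walk_op S P (coin \<mu>) (conv g (inv_fourier (w_o S P \<mu>))) = conv g (inv_fourier (w_o S P \<mu>))"
proof -
  obtain h where h: "square_integrable h" "fcoef h = g"
    using riesz_fischer[OF assms] by blast
  define f where "f = conv g (inv_fourier (w_o S P \<mu>))"
  \<comment> \<open>The transform of the convolution: pointwise a multiple of \<open>w_o\<close>,
    hence fixed by the symbol almost everywhere.\<close>
  define \<phi> where "\<phi> z = h z *s w_o S P \<mu> z" for z
  have \<phi>: "square_integrable (\<lambda>z. \<phi> z $ j)" for j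
    using square_integrable_mult_bounded[OF h(1) w_o_nth_measurable w_o_nth_bounded] by (simp add: \<phi>_def)
  have f: "f x $ j = fcoef (\<lambda>z. \<phi> z $ j) x" for x j
    using conv_inv_fourier_nth[OF h(1)] by (simp add: f_def \<phi>_def h(2))
  have "l2s (\<lambda>x. f x $ j)" for j
    unfolding f using l2s_fcoef[OF \<phi>] by simp
  then show "l2v f" by (simp add: l2v_iff_l2s)
  have "AE z in haar_torus. walk_symbol z (\<phi> z) $ i = \<phi> z $ i" for i
    using AE_regular by eventually_elim (simp only: \<phi>_def walk_symbol_w_o)
  then have "fcoef (\<lambda>z. walk_symbol z (\<phi> z) $ i) = fcoef (\<lambda>z. \<phi> z $ i)" for i
    by (intro fcoef_cong_AE square_integrable_measurable square_integrable_walk_symbol \<phi>)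
  then show "walk_op S P (coin \<mu>) f = f"
    by (simp add: fun_eq_iff vec_eq_iff fcoef_walk_symbol[OF \<phi> f] f)
qed

lemma eigenspace_imp_conv:
  assumes "l2v f" and eig: "walk_op S P (coin \<mu>) f = f"
  shows "\<exists>g. l2s g \<and> f = conv g (inv_fourier (w_o S P \<mu>))"
proof -
  have "\<forall>j. \<exists>h. square_integrable h \<and> fcoef h = (\<lambda>x. f x $ j)"
    using assms(1) riesz_fischer unfolding l2v_iff_l2s by metis
  then obtain H where H: "\<And>j. square_integrable (H j)" "\<And>j. fcoef (H j) = (\<lambda>x. f x $ j)"
    by metis
  define \<phi> where "\<phi> z = (\<chi> j. H j z)" for z
  have \<phi>: "square_integrable (\<lambda>z. \<phi> z $ j)" for j
    using H(1) by (simp add: \<phi>_def)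
  have f: "f x $ j = fcoef (\<lambda>z. \<phi> z $ j) x" for x j
    using H(2) by (simp add: \<phi>_def)
  \<comment> \<open>The eigenvalue equation says that both sides have the same coefficients, so
    uniqueness turns it into a pointwise equation almost everywhere.\<close>
  have "AE z in haar_torus. walk_symbol z (\<phi> z) $ i = \<phi> z $ i" for i
    using fcoef_walk_symbol[OF \<phi> f, where i = i] f eig
    by (intro fcoef_eq_imp_AE_eq square_integrable_integrable square_integrable_walk_symbol \<phi>) (auto simp: fun_eq_iff)
  then have "AE z in haar_torus. \<forall>i\<in>UNIV. walk_symbol z (\<phi> z) $ i = \<phi> z $ i"
    by (intro AE_finite_allI) auto
  then have AE_c: "AE z in haar_torus. \<phi> z = cinner (\<phi> z) (w_o S P \<mu> z) *s w_o S P \<mu> z"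
    using AE_regular by eventually_elim (intro walk_symbol_fixed_imp_w_o, auto simp: vec_eq_iff)
  \<comment> \<open>The multiplier whose coefficients convolve with \<open>w\<close> to give
    \<open>f\<close>. It is square integrable because the components of \<open>w_o\<close> are
    bounded by 1 almost everywhere.\<close>
  define c where "c z = cinner (\<phi> z) (w_o S P \<mu> z)" for z
  have c: "square_integrable c"
    unfolding c_def cinner_def
  proof (intro square_integrable_sum square_integrable_mult_bounded[OF \<phi>])
    fix i
    show "AE z in haar_torus. cmod (cnj (w_o S P \<mu> z $ i)) \<le> 1"
      using w_o_nth_bounded by simp
    show "(\<lambda>z. cnj (w_o S P \<mu> z $ i)) \<in> borel_measurable haar_torus"
      using w_o_nth_measurable by measurable
  qed
  have "f x $ i = conv (fcoef c) (inv_fourier (w_o S P \<mu>)) x $ i" for x i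
  proof -
    have "AE z in haar_torus. \<phi> z $ i = c z * w_o S P \<mu> z $ i"
      using AE_c unfolding c_def[symmetric] by eventually_elim (metis vector_smult_component)
    then have "fcoef (\<lambda>z. \<phi> z $ i) = fcoef (\<lambda>z. c z * w_o S P \<mu> z $ i)"
      by (intro fcoef_cong_AE square_integrable_measurable \<phi>
        square_integrable_mult_bounded[OF c w_o_nth_measurable w_o_nth_bounded])
    then show ?thesis by (simp add: f conv_inv_fourier_nth[OF c])
  qed
  then have "f = conv (fcoef c) (inv_fourier (w_o S P \<mu>))"
    by (simp add: fun_eq_iff vec_eq_iff)
  then show ?thesis using l2s_fcoef[OF c] by blast
qed

end

theorem theorem3p3:
  fixes S :: "(int^'d::finite) set"
    and P :: "int^'d \<Rightarrow> complex^'n::finite^'n"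
    and \<mu> :: "complex^'n"
  assumes "finite S"
    and "\<forall>\<alpha>\<in>S. - \<alpha> \<in> S"
    and "resolution_of_unity S P"
    and "norm \<mu> = 1"
    and "\<forall>\<alpha>\<in>S. norm (P \<alpha> *v \<mu>) = norm (P (- \<alpha>) *v \<mu>)"
  shows "{f. l2v f \<and> walk_op S P (coin \<mu>) f = f}
         = {conv g (inv_fourier (w_o S P \<mu>)) | g. l2s g}"
proof -
  interpret coined_walk S P \<mu>
    by unfold_locales (use assms in blast)+
  show ?thesis
  proof (intro subset_antisym subsetI)
    fix f assume "f \<in> {f. l2v f \<and> walk_op S P (coin \<mu>) f = f}"
    then have "\<exists>g. l2s g \<and> f = conv g (inv_fourier (w_o S P \<mu>))"
      by (intro eigenspace_imp_conv) simp_all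
    then show "f \<in> {conv g (inv_fourier (w_o S P \<mu>)) | g. l2s g}"
      by blast
  next
    fix f assume "f \<in> {conv g (inv_fourier (w_o S P \<mu>)) | g. l2s g}"
    then obtain g where "l2s g" "f = conv g (inv_fourier (w_o S P \<mu>))"
      by blast
    then show "f \<in> {f. l2v f \<and> walk_op S P (coin \<mu>) f = f}"
      using conv_in_eigenspace[of g] by simp
  qed
qed

end
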